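(* Let $d\ge1$, let $\mu$ and $\nu$ be probability distributions supported on a compact set $\mathcal{X}\subset\mathbb{R}^d$ of Euclidean diameter at most $1$, and let $\mu_n$ and $\nu_n$ be empirical distributions of $\mu$ and $\nu$ on $n$ samples. Then for any constants $p\ge1$ and $k>0$, with high probability $$\left|\mathrm{RPW}_{p,k}(\mu,\nu)-\mathrm{RPW}_{p,k}(\mu_n,\nu_n)\right|=\begin{cases}\tilde O(n^{-1/d}), & p\le d/2,\\ \tilde O\!\left(n^{-\frac{p}{p(d+2)-d}}\right), & p>d/2.\end{cases}$$
   Context: The metric is the Euclidean distance $c$. For $p\in[1,\infty)$ and $\alpha\in[0,1]$, a partial transport plan of mass $\alpha$ between probability distributions $\mu,\nu$ is a nonnegative measure $\gamma$ on $\mathcal{X}\times\mathcal{X}$ of total mass $\alpha$ with first marginal $\le\mu$ and second marginal $\le\nu$ (setwise); its cost is $w_p(\gamma)=(\int c^p\,d\gamma)^{1/p}$, and $W_{p,\alpha}(\mu,\nu)$ is the infimum of $w_p(\gamma)$ over such $\gamma$. For $k\ge0$, $\mathrm{RPW}_{p,k}(\mu,\nu)=\inf\{\varepsilon\in[0,1]: W_{p,1-\varepsilon}(\mu,\nu)\le k\varepsilon\}$. An empirical distribution $\mu_n$ is $\frac1n\sum_{i=1}^n\delta_{x_i}$ with $x_i$ i.i.d. from $\mu$ (samples for $\mu_n$, $\nu_n$ drawn independently). $\tilde O(\cdot)$ hides polylogarithmic factors in $n$; "with high probability" means with probability at least $1-n^{-c}$ for some constant $c>0$. *)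

theory Defs
  imports "HOL-Probability.Probability"
begin

definition partial_plan ::
  "real \<Rightarrow> 'a::euclidean_space measure \<Rightarrow> 'a measure \<Rightarrow> ('a \<times> 'a) measure \<Rightarrow> bool" where
  "partial_plan \<alpha> \<mu> \<nu> \<gamma> \<longleftrightarrow>
     sets \<gamma> = sets borel \<and>
     emeasure \<gamma> UNIV = ennreal \<alpha> \<and>
     (\<forall>A \<in> sets borel. emeasure \<gamma> (A \<times> UNIV) \<le> emeasure \<mu> A) \<and>
     (\<forall>B \<in> sets borel. emeasure \<gamma> (UNIV \<times> B) \<le> emeasure \<nu> B)"

definition plan_cost :: "real \<Rightarrow> ('a::euclidean_space \<times> 'a) measure \<Rightarrow> real" where
  "plan_cost p \<gamma> =
     (enn2real (\<integral>\<^sup>+ z. ennreal (dist (fst z) (snd z) powr p) \<partial>\<gamma>)) powr (1 / p)"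

definition partial_W ::
  "real \<Rightarrow> real \<Rightarrow> 'a::euclidean_space measure \<Rightarrow> 'a measure \<Rightarrow> real" where
  "partial_W p \<alpha> \<mu> \<nu> = Inf (plan_cost p ` {\<gamma>. partial_plan \<alpha> \<mu> \<nu> \<gamma>})"

definition RPW :: "real \<Rightarrow> real \<Rightarrow> 'a::euclidean_space measure \<Rightarrow> 'a measure \<Rightarrow> real" where
  "RPW p k \<mu> \<nu> = Inf {\<epsilon> \<in> {0..1}. partial_W p (1 - \<epsilon>) \<mu> \<nu> \<le> k * \<epsilon>}"

definition empirical :: "(nat \<Rightarrow> 'a::euclidean_space) \<Rightarrow> nat \<Rightarrow> 'a measure" where
  "empirical x n = distr (uniform_count_measure {..<n}) borel x"

definition rpw_rate :: "nat \<Rightarrow> real \<Rightarrow> nat \<Rightarrow> real" where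
  "rpw_rate d p n =
     (if p \<le> real d / 2 then real n powr (- 1 / real d)
      else real n powr (- (p / (p * (real d + 2) - real d))))"

end

theory Submission
  imports Defs
begin

text \<open>
  A partial coupling of \<open>\<mu>\<close> and \<open>\<mu>\<^sub>n\<close> that misses mass \<open>e\<close> and costs at most \<open>k e\<close>, composed with a plan
  of \<open>\<mu>\<close> and \<open>\<nu>\<close>, loses at most \<open>e\<close> of its mass and, by Minkowski's inequality, adds at most \<open>k e\<close> to its
  cost. Hence RPW changes by at most \<open>e\<close> when one marginal is replaced.

  The coupling of \<open>\<mu>\<close> and \<open>\<mu>\<^sub>n\<close> matches mass inside dyadic cells, from side \<open>2^-J\<close> with \<open>2^J\<close> about \<open>n^(1/d)\<close>
  up to side \<open>2^-j\<^sub>0\<close>, and gives up the remaining mass. With high probability the cell masses at level \<open>j\<close> differ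
  by about \<open>sqrt (2^(j d) / n)\<close> in total, so the mass lost is about \<open>sqrt (2^(j\<^sub>0 d) / n)\<close>, and level \<open>j\<close> contributes
  about \<open>2^(-j p) sqrt (2^(j d) / n)\<close> to the \<open>p\<close>-th power of the cost. If \<open>p \<le> d / 2\<close> the finest level dominates and
  \<open>j\<^sub>0 = 0\<close> is optimal. If \<open>p > d / 2\<close> the coarsest level dominates, and balancing the lost mass against the cost
  at level \<open>j\<^sub>0\<close> gives \<open>2^-j\<^sub>0 = r^((p - 1) / p)\<close> and the rate \<open>r = n^(-p / (p (d + 2) - d))\<close>.
\<close>

subsection \<open>Hierarchical matching\<close>

text \<open>The constraint \<open>partial_W p (1 - \<epsilon>) \<mu> \<nu> \<le> k *
  \<epsilon>\<close> weighs lost mass and cost against each other linearly, so the coupling of a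
  distribution with its empirical version must achieve the same order r in both. Let p > d/2.
  Stopping at cells of side s loses mass of order s^(-d/2) n^(-1/2), and the p-th power of the cost
  is of order s^p times that. Setting the loss equal to r and the cost power equal to r^p gives s^p
  r = r^p, hence s = r^((p-1)/p); inserting this into the loss gives r^(1 + d(p-1)/(2p)) = n^(-1/2),
  which is the stated exponent. Matching up to side 1 instead would give cost of order n^(-1/(2p)),
  a worse power when p > 1; this is why some mass is abandoned. All marginal conditions are
  inequalities throughout, so a discrepancy between cell masses never has to be repaired, only
  counted.\<close>

definition cell_plan :: "'k set \<Rightarrow> ('k \<Rightarrow> 't) \<Rightarrow> ('k \<Rightarrow> real) \<Rightarrow> ('k \<Rightarrow> real) \<Rightarrow> ('k \<Rightarrow> 'k \<Rightarrow> real) \<Rightarrow> bool" where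
  "cell_plan S c a b G \<longleftrightarrow>
     (\<forall>s\<in>S. \<forall>t\<in>S. 0 \<le> G s t \<and> (c s \<noteq> c t \<longrightarrow> G s t = 0)) \<and>
     (\<forall>s\<in>S. (\<Sum>t\<in>S. G s t) \<le> a s) \<and> (\<forall>t\<in>S. (\<Sum>s\<in>S. G s t) \<le> b t)"

text \<open>The l1 distance of the two mass vectors pushed forward along \<open>c\<close>; for equal
  total masses it is twice their total variation distance.\<close>

definition cell_discrepancy :: "'k set \<Rightarrow> ('k \<Rightarrow> 't) \<Rightarrow> ('k \<Rightarrow> real) \<Rightarrow> ('k \<Rightarrow> real) \<Rightarrow> real" where
  "cell_discrepancy S c a b = (\<Sum>u\<in>c ` S. \<bar>\<Sum>s\<in>{s\<in>S. c s = u}. a s - b s\<bar>)"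

text \<open>All levels share the finest cells \<open>S\<close> as index set and differ only in the
  labelling \<open>c\<close>. A plan built at one level thus serves unchanged as the starting plan
  of the next coarser one.\<close>

lemma cell_plan_coarsen:
  assumes "cell_plan S c a b G"
    and "\<And>s t. s \<in> S \<Longrightarrow> t \<in> S \<Longrightarrow> c s = c t \<Longrightarrow> c' s = c' t"
  shows "cell_plan S c' a b G"
  using assms unfolding cell_plan_def by meson

text \<open>
  Inside each cell the unmatched masses \<open>R\<close> and \<open>U\<close> are coupled proportionally, scaled by the larger
  of the two totals. This exhausts one side, so what is left in a cell is exactly the discrepancy
  of the two masses of that cell.
\<close>
lemma cell_plan_extend:
  fixes w :: "'k \<Rightarrow> 'k \<Rightarrow> real"
  assumes fin: "finite S" and plan: "cell_plan S c a b G" and "0 \<le> D"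
    and w: "\<And>s t. s \<in> S \<Longrightarrow> t \<in> S \<Longrightarrow> c s = c t \<Longrightarrow> w s t \<le> D"
  obtains G' where "cell_plan S c a b G'"
    and "sum a S - (\<Sum>s\<in>S. \<Sum>t\<in>S. G' s t) \<le> cell_discrepancy S c a b"
    and "(\<Sum>s\<in>S. \<Sum>t\<in>S. G' s t * w s t) \<le>
           (\<Sum>s\<in>S. \<Sum>t\<in>S. G s t * w s t) + D * (sum a S - (\<Sum>s\<in>S. \<Sum>t\<in>S. G s t))"
proof -
  define R where "R s = a s - (\<Sum>t\<in>S. G s t)" for s
  define U where "U t = b t - (\<Sum>s\<in>S. G s t)" for t
  define RR where "RR u = (\<Sum>s\<in>{s\<in>S. c s = u}. R s)" for u
  define UU where "UU u = (\<Sum>s\<in>{s\<in>S. c s = u}. U s)" for u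
  define M where "M u = max (RR u) (UU u)" for u
  \<comment> \<open>If both residual totals of a cell vanish, then \<open>M\<close> is 0 and
    division by zero yields 0, which is the correct value.\<close>
  define H where "H s t = (if c t = c s then R s * U t / M (c s) else 0)" for s t
  have R0: "R s \<ge> 0" if "s \<in> S" for s
    using plan that by (simp add: R_def cell_plan_def)
  have U0: "U s \<ge> 0" if "s \<in> S" for s
    using plan that by (simp add: U_def cell_plan_def)
  have RR0: "RR u \<ge> 0" and UU0: "UU u \<ge> 0" for u
    by (auto simp: RR_def UU_def intro!: sum_nonneg R0 U0)
  have M0: "M u \<ge> 0" and MR: "RR u / M u \<le> 1" and MU: "UU u / M u \<le> 1" for u
    using RR0[of u] UU0[of u] by (auto simp: M_def divide_le_eq_1)
  have H0: "H s t \<ge> 0" if "s \<in> S" "t \<in> S" for s t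
    using that by (auto simp: H_def intro!: divide_nonneg_nonneg mult_nonneg_nonneg R0 U0 M0)
  have rowH: "(\<Sum>t\<in>S. H s t) = R s * (UU (c s) / M (c s))" for s
  proof -
    have "(\<Sum>t\<in>S. H s t) = (\<Sum>t\<in>{t\<in>S. c t = c s}. R s * U t / M (c s))"
      unfolding H_def using fin by (simp add: sum.inter_filter)
    also have "\<dots> = R s * (UU (c s) / M (c s))"
      by (simp add: UU_def sum_distrib_left sum_divide_distrib)
    finally show ?thesis .
  qed
  have colH: "(\<Sum>s\<in>S. H s t) = U t * (RR (c t) / M (c t))" for t
  proof -
    have "(\<Sum>s\<in>S. H s t) = (\<Sum>s\<in>S. if c s = c t then R s * U t / M (c t) else 0)"
      by (rule sum.cong) (auto simp: H_def)
    also have "\<dots> = (\<Sum>s\<in>{s\<in>S. c s = c t}. R s * U t / M (c t))"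
      using fin by (simp add: sum.inter_filter)
    also have "\<dots> = U t * (RR (c t) / M (c t))"
      by (simp add: RR_def sum_distrib_left sum_divide_distrib mult.commute)
    finally show ?thesis .
  qed
  have rowH_le: "(\<Sum>t\<in>S. H s t) \<le> R s" if "s \<in> S" for s
    unfolding rowH using MU R0[OF that] by (rule mult_left_le)
  have colH_le: "(\<Sum>s\<in>S. H s t) \<le> U t" if "t \<in> S" for t
    unfolding colH using MR U0[OF that] by (rule mult_left_le)
  \<comment> \<open>\<open>G\<close> pairs only keys of the same cell, so inside a cell its rows and
    columns have the same total and the matched mass cancels. The residual imbalance is therefore
    independent of what was matched at finer levels.\<close>
  have diff: "RR u - UU u = (\<Sum>s\<in>{s\<in>S. c s = u}. a s - b s)" for u
  proof -
    let ?C = "{s\<in>S. c s = u}"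
    have sub: "(\<Sum>t\<in>S. G s t) = (\<Sum>t\<in>?C. G s t)" "(\<Sum>t\<in>S. G t s) = (\<Sum>t\<in>?C. G t s)" if "s \<in> ?C" for s
      using that plan fin by (intro sum.mono_neutral_right; force simp: cell_plan_def)+
    have "(\<Sum>s\<in>?C. \<Sum>t\<in>S. G s t) = (\<Sum>s\<in>?C. \<Sum>t\<in>?C. G s t)"
      by (rule sum.cong) (auto simp: sub)
    also have "\<dots> = (\<Sum>s\<in>?C. \<Sum>t\<in>?C. G t s)"
      by (rule sum.swap)
    also have "\<dots> = (\<Sum>s\<in>?C. \<Sum>t\<in>S. G t s)"
      by (rule sum.cong) (auto simp: sub)
    finally show ?thesis
      by (simp add: RR_def UU_def R_def U_def sum_subtractf)
  qed
  have mass: "(\<Sum>s\<in>S. R s - (\<Sum>t\<in>S. H s t)) \<le> cell_discrepancy S c a b"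
  proof -
    have "(\<Sum>s\<in>S. R s - (\<Sum>t\<in>S. H s t)) = (\<Sum>s\<in>S. R s * (1 - UU (c s) / M (c s)))"
      by (simp add: rowH algebra_simps)
    also have "\<dots> = (\<Sum>u\<in>c ` S. \<Sum>s\<in>{s\<in>S. c s = u}. R s * (1 - UU (c s) / M (c s)))"
      by (rule sum.image_gen[OF fin])
    also have "\<dots> = (\<Sum>u\<in>c ` S. RR u * (1 - UU u / M u))"
      by (rule sum.cong) (auto simp: RR_def sum_distrib_right)
    also have "\<dots> \<le> (\<Sum>u\<in>c ` S. \<bar>RR u - UU u\<bar>)"
    proof (rule sum_mono)
      fix u
      show "RR u * (1 - UU u / M u) \<le> \<bar>RR u - UU u\<bar>"
      proof (cases "UU u \<le> RR u")
        case True
        then show ?thesis using RR0[of u] UU0[of u]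
          by (cases "RR u = 0") (auto simp: M_def max_def field_simps)
      next
        case False
        then show ?thesis using RR0[of u] by (auto simp: M_def max_def)
      qed
    qed
    also have "\<dots> = cell_discrepancy S c a b"
      by (simp add: diff cell_discrepancy_def)
    finally show ?thesis .
  qed
  have Rsum: "sum R S = sum a S - (\<Sum>s\<in>S. \<Sum>t\<in>S. G s t)"
    by (simp add: R_def sum_subtractf)
  show ?thesis
  proof (rule that[of "\<lambda>s t. G s t + H s t"])
    show "cell_plan S c a b (\<lambda>s t. G s t + H s t)"
      using plan rowH_le colH_le H0 unfolding cell_plan_def R_def U_def
      by (auto simp: sum.distrib H_def[of _ _] algebra_simps intro: add_nonneg_nonneg)
    show "sum a S - (\<Sum>s\<in>S. \<Sum>t\<in>S. G s t + H s t) \<le> cell_discrepancy S c a b"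
      using mass by (simp add: sum.distrib sum_subtractf Rsum)
    have "(\<Sum>s\<in>S. \<Sum>t\<in>S. H s t * w s t) \<le> (\<Sum>s\<in>S. \<Sum>t\<in>S. H s t * D)"
    proof (intro sum_mono)
      fix s t assume st: "s \<in> S" "t \<in> S"
      show "H s t * w s t \<le> H s t * D"
      proof (cases "c t = c s")
        case True
        then show ?thesis using st by (intro mult_left_mono w H0) auto
      qed (simp add: H_def)
    qed
    also have "\<dots> = D * (\<Sum>s\<in>S. \<Sum>t\<in>S. H s t)"
      by (simp add: sum_distrib_left mult.commute)
    also have "\<dots> \<le> D * sum R S"
      by (intro mult_left_mono sum_mono rowH_le \<open>0 \<le> D\<close>)
    finally show "(\<Sum>s\<in>S. \<Sum>t\<in>S. (G s t + H s t) * w s t) \<le>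
           (\<Sum>s\<in>S. \<Sum>t\<in>S. G s t * w s t) + D * (sum a S - (\<Sum>s\<in>S. \<Sum>t\<in>S. G s t))"
      by (simp add: Rsum distrib_right sum.distrib)
  qed
qed

text \<open>The mass still unmatched after level \<open>Suc j\<close> is at most the discrepancy of
  that level, and level \<open>j\<close> moves it at unit cost at most \<open>D j\<close>; hence
  each such level contributes at most \<open>K\<close>. The finest level starts from the empty plan
  and may move the whole mass 1, which is why \<open>D J \<le> K\<close> is a separate hypothesis.
  The factor \<open>Suc (J - j\<^sub>0)\<close> counts the levels.\<close>

lemma hierarchical_matching:
  fixes a b :: "'k \<Rightarrow> real" and c :: "nat \<Rightarrow> 'k \<Rightarrow> 't" and w :: "'k \<Rightarrow> 'k \<Rightarrow> real"
  assumes fin: "finite S" and a: "\<And>s. s \<in> S \<Longrightarrow> 0 \<le> a s" and b: "\<And>s. s \<in> S \<Longrightarrow> 0 \<le> b s"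
    and a1: "sum a S = 1" and "j\<^sub>0 \<le> J"
    and nest: "\<And>j s t. j < J \<Longrightarrow> s \<in> S \<Longrightarrow> t \<in> S \<Longrightarrow> c (Suc j) s = c (Suc j) t \<Longrightarrow> c j s = c j t"
    and w: "\<And>j s t. j \<le> J \<Longrightarrow> s \<in> S \<Longrightarrow> t \<in> S \<Longrightarrow> c j s = c j t \<Longrightarrow> w s t \<le> D j"
    and D: "\<And>j. 0 \<le> D j"
    and KJ: "D J \<le> K"
    and K: "\<And>j. j\<^sub>0 \<le> j \<Longrightarrow> j < J \<Longrightarrow> D j * cell_discrepancy S (c (Suc j)) a b \<le> K"
  obtains G where "cell_plan S (c j\<^sub>0) a b G"
    and "1 - (\<Sum>s\<in>S. \<Sum>t\<in>S. G s t) \<le> cell_discrepancy S (c j\<^sub>0) a b"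
    and "(\<Sum>s\<in>S. \<Sum>t\<in>S. G s t * w s t) \<le> real (Suc (J - j\<^sub>0)) * K"
proof -
  have "\<exists>G. cell_plan S (c (J - i)) a b G \<and>
      1 - (\<Sum>s\<in>S. \<Sum>t\<in>S. G s t) \<le> cell_discrepancy S (c (J - i)) a b \<and>
      (\<Sum>s\<in>S. \<Sum>t\<in>S. G s t * w s t) \<le> real (Suc i) * K" if "i \<le> J - j\<^sub>0" for i
    using that
  \<comment> \<open>The induction runs from fine to coarse: \<open>i\<close> counts the levels
    climbed from \<open>J\<close>.\<close>
  proof (induction i)
    case 0
    have "cell_plan S (c J) a b (\<lambda>_ _. 0)"
      using a b by (simp add: cell_plan_def)
    from cell_plan_extend[OF fin this D[of J], of w] w[of J] obtain G where
      "cell_plan S (c J) a b G" "sum a S - (\<Sum>s\<in>S. \<Sum>t\<in>S. G s t) \<le> cell_discrepancy S (c J) a b"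
      "(\<Sum>s\<in>S. \<Sum>t\<in>S. G s t * w s t) \<le> D J * sum a S"
      by auto
    with a1 KJ show ?case by auto
  next
    case (Suc i)
    define j where "j = J - Suc i"
    have j: "J - i = Suc j" "j < J" "j\<^sub>0 \<le> j" using Suc.prems by (auto simp: j_def)
    from Suc obtain G where G: "cell_plan S (c (Suc j)) a b G"
      "1 - (\<Sum>s\<in>S. \<Sum>t\<in>S. G s t) \<le> cell_discrepancy S (c (Suc j)) a b"
      "(\<Sum>s\<in>S. \<Sum>t\<in>S. G s t * w s t) \<le> real (Suc i) * K"
      by (auto simp: j)
    have "cell_plan S (c j) a b G"
      using G(1) nest[OF j(2)] by (rule cell_plan_coarsen)
    have wj: "w s t \<le> D j" if "s \<in> S" "t \<in> S" "c j s = c j t" for s t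
      using w[of j s t] that j by auto
    from cell_plan_extend[of S "c j" a b G "D j" w, OF fin \<open>cell_plan S (c j) a b G\<close> D wj] obtain G' where
      G': "cell_plan S (c j) a b G'" "sum a S - (\<Sum>s\<in>S. \<Sum>t\<in>S. G' s t) \<le> cell_discrepancy S (c j) a b"
      "(\<Sum>s\<in>S. \<Sum>t\<in>S. G' s t * w s t) \<le>
        (\<Sum>s\<in>S. \<Sum>t\<in>S. G s t * w s t) + D j * (sum a S - (\<Sum>s\<in>S. \<Sum>t\<in>S. G s t))"
      by blast
    have "D j * (sum a S - (\<Sum>s\<in>S. \<Sum>t\<in>S. G s t)) \<le> D j * cell_discrepancy S (c (Suc j)) a b"
      using G(2) D[of j] a1 by (intro mult_left_mono) auto
    also have "\<dots> \<le> K" using K j by auto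
    finally have "(\<Sum>s\<in>S. \<Sum>t\<in>S. G' s t * w s t) \<le> real (Suc (Suc i)) * K"
      using G'(3) G(3) by (simp add: algebra_simps)
    with G' a1 show ?case unfolding j_def[symmetric] by auto
  qed
  from this[of "J - j\<^sub>0"] \<open>j\<^sub>0 \<le> J\<close> that show ?thesis by auto
qed

subsection \<open>Gluing partial plans\<close>

lemma powr_add_le_convex:
  fixes u v l p :: real
  assumes "0 \<le> u" "0 \<le> v" "0 < l" "l < 1" "1 \<le> p"
  shows "(u + v) powr p \<le> l * (u / l) powr p + (1 - l) * (v / (1 - l)) powr p"
proof -
  have single: "v powr p \<le> l * (v / l) powr p" if "0 \<le> v" "0 < l" "l < 1" for v l :: real
  proof -
    have "l powr p \<le> l powr 1"
      using that \<open>1 \<le> p\<close> by (intro powr_mono') auto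
    then have "v powr p * l powr p \<le> v powr p * l"
      using that by (intro mult_left_mono) auto
    then show ?thesis
      using that by (simp add: powr_divide field_simps)
  qed
  consider "u = 0" | "v = 0" | "u > 0" "v > 0"
    using assms by linarith
  then show ?thesis
  proof cases
    case 1
    then show ?thesis using single[of v "1 - l"] assms by simp
  next
    case 2
    then show ?thesis using single[of u l] assms by simp
  next
    case 3
    have "(\<lambda>x. x powr p) ((1 - (1 - l)) *\<^sub>R (u / l) + (1 - l) *\<^sub>R (v / (1 - l)))
        \<le> (1 - (1 - l)) * (u / l) powr p + (1 - l) * (v / (1 - l)) powr p"
      using 3 assms by (intro convex_onD[OF powr_convex[OF \<open>1 \<le> p\<close>]]) auto
    then show ?thesis using assms by simp
  qed
qed

text \<open>Convexity of the p-th power with a fixed weight \<open>l\<close>, integrated, suffices: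
  only upper bounds \<open>A\<close> and \<open>B\<close> on the two norms are given, and the weight
  is chosen from them.\<close>

lemma nn_integral_powr_Minkowski:
  fixes f g :: "'b \<Rightarrow> real"
  assumes [measurable]: "f \<in> borel_measurable M" "g \<in> borel_measurable M"
    and f0: "\<And>x. 0 \<le> f x" and g0: "\<And>x. 0 \<le> g x"
    and "0 \<le> A" "0 \<le> B" "1 \<le> p"
    and f: "(\<integral>\<^sup>+x. ennreal (f x powr p) \<partial>M) \<le> ennreal (A powr p)"
    and g: "(\<integral>\<^sup>+x. ennreal (g x powr p) \<partial>M) \<le> ennreal (B powr p)"
  shows "(\<integral>\<^sup>+x. ennreal ((f x + g x) powr p) \<partial>M) \<le> ennreal ((A + B) powr p)"
proof -
  \<comment> \<open>A norm bound of 0 would make the weight \<open>l\<close> degenerate, but it also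
    makes the function vanish almost everywhere.\<close>
  have zero: "(\<integral>\<^sup>+x. ennreal ((f x + g x) powr p) \<partial>M) = (\<integral>\<^sup>+x. ennreal (g x powr p) \<partial>M)"
    if "(\<integral>\<^sup>+x. ennreal (f x powr p) \<partial>M) = 0"
      and [measurable]: "f \<in> borel_measurable M" "g \<in> borel_measurable M" for f g :: "'b \<Rightarrow> real"
  proof -
    have "AE x in M. ennreal (f x powr p) = 0"
      using that(1) by (subst (asm) nn_integral_0_iff_AE) auto
    then have "AE x in M. f x = 0"
      by (auto elim!: AE_mp simp: ennreal_eq_0_iff)
    then show ?thesis
      by (intro nn_integral_cong_AE) auto
  qed
  consider "A = 0" | "B = 0" | "A > 0" "B > 0"
    using assms by linarith
  then show ?thesis
  proof cases
    case 1
    then show ?thesis using zero[of f g] f g \<open>1 \<le> p\<close> by simp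
  next
    case 2
    then show ?thesis using zero[of g f] f g \<open>1 \<le> p\<close> by (simp add: add.commute)
  next
    case 3
    \<comment> \<open>This weight makes \<open>A / l\<close> and \<open>B / (1 - l)\<close> both
      equal to \<open>A + B\<close>, so the convex combination of the bounds collapses to
      \<open>(A + B) powr p\<close>.\<close>
    define l where "l = A / (A + B)"
    have l: "0 < l" "l < 1" "1 - l = B / (A + B)"
      using 3 by (auto simp: l_def field_simps)
    have scale: "ennreal c * (\<integral>\<^sup>+x. ennreal ((f x / c) powr p) \<partial>M) \<le> ennreal (c * (A / c) powr p)"
      if "c > 0" "\<And>x. 0 \<le> f x" "0 \<le> A" "f \<in> borel_measurable M"
        "(\<integral>\<^sup>+x. ennreal (f x powr p) \<partial>M) \<le> ennreal (A powr p)" for c A and f :: "'b \<Rightarrow> real"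
    proof -
      have [measurable]: "f \<in> borel_measurable M" by fact
      have "(\<integral>\<^sup>+x. ennreal ((f x / c) powr p) \<partial>M) = (\<integral>\<^sup>+x. ennreal (1 / c powr p) * ennreal (f x powr p) \<partial>M)"
        using that by (intro nn_integral_cong) (auto simp: powr_divide simp flip: ennreal_mult)
      also have "\<dots> = ennreal (1 / c powr p) * (\<integral>\<^sup>+x. ennreal (f x powr p) \<partial>M)"
        by (rule nn_integral_cmult) simp
      also have "\<dots> \<le> ennreal (1 / c powr p) * ennreal (A powr p)"
        by (intro mult_left_mono that) simp
      also have "\<dots> = ennreal ((A / c) powr p)"
        using that by (simp add: powr_divide flip: ennreal_mult)
      finally have "ennreal c * (\<integral>\<^sup>+x. ennreal ((f x / c) powr p) \<partial>M) \<le> ennreal c * ennreal ((A / c) powr p)"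
        by (intro mult_left_mono) auto
      then show ?thesis using that by (simp add: ennreal_mult)
    qed
    have "(\<integral>\<^sup>+x. ennreal ((f x + g x) powr p) \<partial>M) \<le>
        (\<integral>\<^sup>+x. ennreal l * ennreal ((f x / l) powr p) + ennreal (1 - l) * ennreal ((g x / (1 - l)) powr p) \<partial>M)"
    proof (intro nn_integral_mono)
      fix x
      have "(f x + g x) powr p \<le> l * (f x / l) powr p + (1 - l) * (g x / (1 - l)) powr p"
        using f0 g0 l(1,2) \<open>1 \<le> p\<close> by (rule powr_add_le_convex)
      then show "ennreal ((f x + g x) powr p) \<le>
          ennreal l * ennreal ((f x / l) powr p) + ennreal (1 - l) * ennreal ((g x / (1 - l)) powr p)"
        using l(1,2) by (simp add: ennreal_leI flip: ennreal_mult ennreal_plus)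
    qed
    also have "\<dots> = ennreal l * (\<integral>\<^sup>+x. ennreal ((f x / l) powr p) \<partial>M) +
        ennreal (1 - l) * (\<integral>\<^sup>+x. ennreal ((g x / (1 - l)) powr p) \<partial>M)"
      by (simp add: nn_integral_add nn_integral_cmult)
    also have "\<dots> \<le> ennreal (l * (A / l) powr p) + ennreal ((1 - l) * (B / (1 - l)) powr p)"
      using l assms by (intro add_mono scale) auto
    also have "\<dots> = ennreal (l * (A / l) powr p + (1 - l) * (B / (1 - l)) powr p)"
      using l(1,2) by (simp add: ennreal_plus)
    also have "l * (A / l) powr p + (1 - l) * (B / (1 - l)) powr p = (A + B) powr p"
    proof -
      have "A / l = A + B" "B / (1 - l) = A + B"
        unfolding l(3) using 3 by (auto simp: l_def)
      then show ?thesis by (simp add: algebra_simps)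
    qed
    finally show ?thesis .
  qed
qed

section \<open>Operations on partial plans and transport densities\<close>

lemma borel_measurable_dist_powr [measurable]:
  "(\<lambda>z :: 'a::euclidean_space \<times> 'a. ennreal (dist (fst z) (snd z) powr p)) \<in> borel_measurable borel"
  unfolding borel_prod[symmetric] by measurable

lemma measurable_fst_borel [measurable]:
  "(fst :: 'a::euclidean_space \<times> 'b::euclidean_space \<Rightarrow> 'a) \<in> borel_measurable borel"
  unfolding borel_prod[symmetric] by measurable

lemma measurable_swap_borel [measurable]:
  "(prod.swap :: 'a::euclidean_space \<times> 'b::euclidean_space \<Rightarrow> 'b \<times> 'a) \<in> borel_measurable borel"
  by (intro borel_measurable_continuous_onI continuous_intros)

text \<open>Bounding the extended-valued integral keeps an infinite cost apart from cost 0, and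
  speaking of an actual plan allows composition without reference to an infimum.\<close>

definition plan_within ::
  "real \<Rightarrow> real \<Rightarrow> real \<Rightarrow> 'a::euclidean_space measure \<Rightarrow> 'a measure \<Rightarrow> bool" where
  "plan_within p \<alpha> D \<mu> \<nu> \<longleftrightarrow>
     (\<exists>\<gamma>. partial_plan \<alpha> \<mu> \<nu> \<gamma> \<and>
        (\<integral>\<^sup>+z. ennreal (dist (fst z) (snd z) powr p) \<partial>\<gamma>) \<le> ennreal (D powr p))"

text \<open>
  A partial coupling given by a density with respect to the product measure. Such couplings can be
  composed with an arbitrary plan by Fubini alone, without disintegration.
\<close>
definition transport_density ::
  "real \<Rightarrow> real \<Rightarrow> real \<Rightarrow> 'a::euclidean_space measure \<Rightarrow> 'a measure \<Rightarrow> ('a \<times> 'a \<Rightarrow> ennreal) \<Rightarrow> bool" where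
  "transport_density p \<epsilon> D \<mu> \<mu>' h \<longleftrightarrow>
     h \<in> borel_measurable borel \<and>
     (\<forall>x. (\<integral>\<^sup>+y. h (x, y) \<partial>\<mu>') \<le> 1) \<and> (\<forall>y. (\<integral>\<^sup>+x. h (x, y) \<partial>\<mu>) \<le> 1) \<and>
     1 \<le> (\<integral>\<^sup>+x. \<integral>\<^sup>+y. h (x, y) \<partial>\<mu>' \<partial>\<mu>) + ennreal \<epsilon> \<and>
     (\<integral>\<^sup>+x. \<integral>\<^sup>+y. h (x, y) * ennreal (dist x y powr p) \<partial>\<mu>' \<partial>\<mu>) \<le> ennreal (D powr p)"

lemma transport_density_swap:
  fixes \<mu> \<mu>' :: "'a::euclidean_space measure"
  assumes "transport_density p \<epsilon> D \<mu> \<mu>' h"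
    and "prob_space \<mu>" "prob_space \<mu>'"
    and [measurable_cong]: "sets \<mu> = sets borel" "sets \<mu>' = sets borel"
  shows "transport_density p \<epsilon> D \<mu>' \<mu> (\<lambda>z. h (snd z, fst z))"
proof -
  interpret \<mu>: prob_space \<mu> by fact
  interpret \<mu>': prob_space \<mu>' by fact
  interpret P: pair_sigma_finite \<mu> \<mu>' by unfold_locales
  have h: "h \<in> borel_measurable borel"
    using assms by (simp add: transport_density_def)
  then have [measurable]: "h \<in> borel_measurable (borel \<Otimes>\<^sub>M borel)"
    by (simp add: borel_prod)
  have "(\<lambda>z. h (snd z, fst z)) \<in> borel_measurable (borel \<Otimes>\<^sub>M borel)"
    by measurable
  then have "(\<lambda>z. h (snd z, fst z)) \<in> borel_measurable borel"
    by (simp add: borel_prod)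
  moreover have "(\<integral>\<^sup>+y. \<integral>\<^sup>+x. h (x, y) \<partial>\<mu> \<partial>\<mu>') = (\<integral>\<^sup>+x. \<integral>\<^sup>+y. h (x, y) \<partial>\<mu>' \<partial>\<mu>)"
    by (rule P.Fubini') measurable
  moreover have "(\<integral>\<^sup>+y. \<integral>\<^sup>+x. h (x, y) * ennreal (dist x y powr p) \<partial>\<mu> \<partial>\<mu>') =
      (\<integral>\<^sup>+x. \<integral>\<^sup>+y. h (x, y) * ennreal (dist x y powr p) \<partial>\<mu>' \<partial>\<mu>)"
    by (rule P.Fubini') measurable
  ultimately show ?thesis
    using assms(1) by (simp add: transport_density_def dist_commute)
qed

text \<open>Extends marginal domination from sets to nonnegative functions. In the gluing it reduces
  the column sums, the lost mass and the added cost from an arbitrary plan to integrals against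
  \<mu>, where the density is controlled.\<close>

lemma partial_plan_fst_le:
  assumes "partial_plan \<alpha> \<mu> \<nu> \<gamma>" and "sets \<mu> = sets borel" and [measurable]: "f \<in> borel_measurable borel"
  shows "(\<integral>\<^sup>+z. f (fst z) \<partial>\<gamma>) \<le> (\<integral>\<^sup>+x. f x \<partial>\<mu>)"
proof -
  have g [measurable_cong]: "sets \<gamma> = sets borel"
    using assms(1) by (simp add: partial_plan_def)
  have sp: "space \<gamma> = UNIV"
    using sets_eq_imp_space_eq[OF g] by simp
  have "distr \<gamma> borel fst \<le> \<mu>"
  proof (subst le_measure)
    show "\<forall>A\<in>sets (distr \<gamma> borel fst). emeasure (distr \<gamma> borel fst) A \<le> emeasure \<mu> A"
    proof
      fix A assume "A \<in> sets (distr \<gamma> borel fst)"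
      then have A: "A \<in> sets borel" by simp
      have "fst -` A \<inter> space \<gamma> = A \<times> UNIV" using sp by auto
      then show "emeasure (distr \<gamma> borel fst) A \<le> emeasure \<mu> A"
        using A assms(1) by (simp add: emeasure_distr partial_plan_def)
    qed
  qed (simp add: assms)
  then have "(\<integral>\<^sup>+x. f x \<partial>distr \<gamma> borel fst) \<le> (\<integral>\<^sup>+x. f x \<partial>\<mu>)"
    by (intro nn_integral_mono_measure) (simp_all add: assms)
  then show ?thesis
    by (simp add: nn_integral_distr)
qed

lemma partial_plan_swap:
  assumes "partial_plan \<alpha> \<mu> \<nu> \<gamma>"
  shows "partial_plan \<alpha> \<nu> \<mu> (distr \<gamma> borel prod.swap)"
proof -
  have g [measurable_cong]: "sets \<gamma> = sets borel"
    using assms(1) by (simp add: partial_plan_def)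
  have sp: "space \<gamma> = UNIV"
    using sets_eq_imp_space_eq[OF g] by simp
  have "A \<times> B \<in> sets borel" if "A \<in> sets borel" "B \<in> sets borel" for A B :: "'a set"
    using that by (simp flip: borel_prod)
  moreover have "prod.swap -` (A \<times> B) = B \<times> A" for A B :: "'a set"
    by auto
  ultimately show ?thesis
    using assms by (simp add: partial_plan_def emeasure_distr sp)
qed

lemma plan_within_swap:
  assumes "plan_within p \<alpha> D \<mu> \<nu>"
  shows "plan_within p \<alpha> D \<nu> \<mu>"
proof -
  obtain \<gamma> where \<gamma>: "partial_plan \<alpha> \<mu> \<nu> \<gamma>"
    "(\<integral>\<^sup>+z. ennreal (dist (fst z) (snd z) powr p) \<partial>\<gamma>) \<le> ennreal (D powr p)"
    using assms by (auto simp: plan_within_def)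
  have g [measurable_cong]: "sets \<gamma> = sets borel"
    using \<gamma> by (simp add: partial_plan_def)
  have "(\<integral>\<^sup>+z. ennreal (dist (fst z) (snd z) powr p) \<partial>distr \<gamma> borel prod.swap) =
      (\<integral>\<^sup>+z. ennreal (dist (fst (prod.swap z)) (snd (prod.swap z)) powr p) \<partial>\<gamma>)"
    using borel_measurable_dist_powr by (intro nn_integral_distr) (auto simp only: measurable_distr_eq1, measurable)
  with \<gamma> partial_plan_swap[OF \<gamma>(1)] show ?thesis
    unfolding plan_within_def by (auto simp: dist_commute)
qed

text \<open>A partial plan has a prescribed mass, whereas gluing only bounds the resulting mass from
  below. Scaling down removes the excess, and marginals and cost can only shrink.\<close>

lemma plan_within_scale:
  assumes "plan_within p m D \<mu> \<nu>" "0 \<le> \<alpha>" "\<alpha> \<le> m"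
  shows "plan_within p \<alpha> D \<mu> \<nu>"
proof -
  obtain \<gamma> where \<gamma>: "partial_plan m \<mu> \<nu> \<gamma>"
    "(\<integral>\<^sup>+z. ennreal (dist (fst z) (snd z) powr p) \<partial>\<gamma>) \<le> ennreal (D powr p)"
    using assms by (auto simp: plan_within_def)
  have g [measurable_cong]: "sets \<gamma> = sets borel"
    using \<gamma> by (simp add: partial_plan_def)
  \<comment> \<open>If \<open>m = 0\<close> then \<alpha> is 0 as well, and the default value 0 of
    the quotient is the right factor.\<close>
  define r where "r = ennreal (\<alpha> / m)"
  have "r \<le> ennreal 1" unfolding r_def
    using assms by (intro ennreal_leI) (auto simp: divide_le_eq_1)
  then have r1: "r \<le> 1" by simp
  have shrink: "r * x \<le> y" if "x \<le> y" for x y :: ennreal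
    using mult_mono[OF r1 that] by simp
  have "r * ennreal m = ennreal \<alpha>"
    using assms by (cases "m = 0") (auto simp: r_def simp flip: ennreal_mult)
  then have "partial_plan \<alpha> \<mu> \<nu> (scale_measure r \<gamma>)"
    using \<gamma> by (auto simp: partial_plan_def intro!: shrink)
  moreover have "(\<integral>\<^sup>+z. ennreal (dist (fst z) (snd z) powr p) \<partial>scale_measure r \<gamma>) \<le> ennreal (D powr p)"
    using \<gamma>(2) borel_measurable_dist_powr[of p]
    by (subst nn_integral_scale_measure) (simp_all add: shrink measurable_cong_sets[OF g refl])
  ultimately show ?thesis
    by (auto simp: plan_within_def)
qed

text \<open>Each pair (x, z) of the given plan has its first point x moved to y with density
  \<open>h (x, y)\<close>; the glued plan consists of the pairs (y, z). Row sums of \<open>h\<close>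
  at most 1 preserve the marginal \<nu>, column sums at most 1 give the marginal \<mu>'. The
  distance of y and z is estimated through x, and Minkowski's inequality adds the two costs.\<close>

lemma plan_within_glue:
  fixes \<mu> \<mu>' \<nu> :: "'a::euclidean_space measure"
  assumes within: "plan_within p \<alpha> D\<^sub>0 \<mu> \<nu>" and td: "transport_density p \<epsilon> D \<mu> \<mu>' h"
    and "prob_space \<mu>" "prob_space \<mu>'"
    and s [measurable_cong]: "sets \<mu> = sets borel" "sets \<mu>' = sets borel"
    and "1 \<le> p" "0 \<le> D\<^sub>0" "0 \<le> D" "0 \<le> \<epsilon>" "\<epsilon> \<le> \<alpha>"
  shows "plan_within p (\<alpha> - \<epsilon>) (D\<^sub>0 + D) \<mu>' \<nu>"
proof -
  interpret \<mu>: prob_space \<mu> by fact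
  interpret \<mu>': prob_space \<mu>' by fact
  obtain \<pi> where \<pi>: "partial_plan \<alpha> \<mu> \<nu> \<pi>"
    and cost: "(\<integral>\<^sup>+z. ennreal (dist (fst z) (snd z) powr p) \<partial>\<pi>) \<le> ennreal (D\<^sub>0 powr p)"
    using within by (auto simp: plan_within_def)
  have g: "sets \<pi> = sets borel"
    using \<pi> by (simp add: partial_plan_def)
  then have g' [measurable_cong]: "sets \<pi> = sets (borel \<Otimes>\<^sub>M borel)"
    by (simp only: borel_prod)
  have sp: "space \<pi> = UNIV" "space \<mu>' = UNIV" "space \<mu> = UNIV"
    using sets_eq_imp_space_eq[OF g] sets_eq_imp_space_eq[OF s(1)] sets_eq_imp_space_eq[OF s(2)] by simp_all
  have mass_\<pi>: "emeasure \<pi> UNIV = ennreal \<alpha>"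
    using \<pi> by (simp add: partial_plan_def)
  interpret \<pi>: finite_measure \<pi>
    by (rule finite_measureI) (simp add: sp mass_\<pi>)
  interpret P: pair_sigma_finite \<pi> \<mu>' by unfold_locales
  have "h \<in> borel_measurable borel"
    using td by (simp add: transport_density_def)
  then have h [measurable]: "h \<in> borel_measurable (borel \<Otimes>\<^sub>M borel)"
    by (simp add: borel_prod)
  define H where "H x = (\<integral>\<^sup>+y. h (x, y) \<partial>\<mu>')" for x
  have H [measurable]: "H \<in> borel_measurable borel"
    unfolding H_def by measurable
  have H1: "H x \<le> 1" for x
    using td by (simp add: H_def transport_density_def)
  \<comment> \<open>\<open>Q\<close> lives on triples \<open>((x, z), y)\<close>; the map
    \<open>f\<close> below forgets the intermediate point x.\<close>
  define Q where "Q = density (\<pi> \<Otimes>\<^sub>M \<mu>') (\<lambda>\<omega>. h (fst (fst \<omega>), snd \<omega>))"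
  define f where "f = (\<lambda>\<omega> :: ('a \<times> 'a) \<times> 'a. (snd \<omega>, snd (fst \<omega>)))"
  have f [measurable]: "f \<in> measurable Q borel"
    unfolding f_def Q_def borel_prod[symmetric] by measurable
  define \<gamma> where "\<gamma> = distr Q borel f"
  \<comment> \<open>The two orders of integration serve different bounds: integrating y first uses
    the row sums of \<open>h\<close>, integrating over the plan first uses its column sums.\<close>
  have IQ: "(\<integral>\<^sup>+\<omega>. \<phi> \<omega> \<partial>Q) = (\<integral>\<^sup>+z. \<integral>\<^sup>+y. h (fst z, y) * \<phi> (z, y) \<partial>\<mu>' \<partial>\<pi>)"
    if [measurable]: "\<phi> \<in> borel_measurable (\<pi> \<Otimes>\<^sub>M \<mu>')" for \<phi>
  proof -
    have "(\<integral>\<^sup>+\<omega>. \<phi> \<omega> \<partial>Q) = (\<integral>\<^sup>+\<omega>. h (fst (fst \<omega>), snd \<omega>) * \<phi> \<omega> \<partial>(\<pi> \<Otimes>\<^sub>M \<mu>'))"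
      unfolding Q_def by (rule nn_integral_density) measurable
    also have "\<dots> = (\<integral>\<^sup>+z. \<integral>\<^sup>+y. h (fst z, y) * \<phi> (z, y) \<partial>\<mu>' \<partial>\<pi>)"
      by (subst \<mu>'.nn_integral_fst[symmetric]) simp_all
    finally show ?thesis .
  qed
  have IQ': "(\<integral>\<^sup>+\<omega>. \<phi> \<omega> \<partial>Q) = (\<integral>\<^sup>+y. \<integral>\<^sup>+z. h (fst z, y) * \<phi> (z, y) \<partial>\<pi> \<partial>\<mu>')"
    if [measurable]: "\<phi> \<in> borel_measurable (\<pi> \<Otimes>\<^sub>M \<mu>')" for \<phi>
    unfolding IQ[OF that] by (rule P.Fubini'[symmetric]) measurable
  have ind: "emeasure \<gamma> Z = (\<integral>\<^sup>+\<omega>. indicator Z (f \<omega>) \<partial>Q)" if "Z \<in> sets borel" for Z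
  proof -
    have "emeasure \<gamma> Z = (\<integral>\<^sup>+z. indicator Z z \<partial>\<gamma>)"
      using that by (simp add: \<gamma>_def)
    also have "\<dots> = (\<integral>\<^sup>+\<omega>. indicator Z (f \<omega>) \<partial>Q)"
      unfolding \<gamma>_def using that by (intro nn_integral_distr f) auto
    finally show ?thesis .
  qed
  have row: "emeasure \<gamma> (A \<times> UNIV) \<le> emeasure \<mu>' A" if A [measurable]: "A \<in> sets borel" for A
  proof -
    have "A \<times> UNIV \<in> sets (borel :: ('a \<times> 'a) measure)"
      using A by (auto simp flip: borel_prod)
    then have "emeasure \<gamma> (A \<times> UNIV) = (\<integral>\<^sup>+\<omega>. indicator A (snd \<omega>) \<partial>Q)"
      by (simp add: ind f_def indicator_times)
    also have "\<dots> = (\<integral>\<^sup>+y. \<integral>\<^sup>+z. h (fst z, y) * indicator A y \<partial>\<pi> \<partial>\<mu>')"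
      by (subst IQ') simp_all
    also have "\<dots> \<le> (\<integral>\<^sup>+y. indicator A y \<partial>\<mu>')"
    proof (intro nn_integral_mono)
      fix y
      have "(\<integral>\<^sup>+z. h (fst z, y) \<partial>\<pi>) \<le> (\<integral>\<^sup>+x. h (x, y) \<partial>\<mu>)"
        by (rule partial_plan_fst_le[OF \<pi>]) (simp_all add: s)
      also have "\<dots> \<le> 1"
        using td by (simp add: transport_density_def)
      finally show "(\<integral>\<^sup>+z. h (fst z, y) * indicator A y \<partial>\<pi>) \<le> indicator A y"
        by (cases "y \<in> A") auto
    qed
    finally show ?thesis by simp
  qed
  have col: "emeasure \<gamma> (UNIV \<times> B) \<le> emeasure \<nu> B" if B [measurable]: "B \<in> sets borel" for B
  proof -
    have UB: "UNIV \<times> B \<in> sets (borel :: ('a \<times> 'a) measure)"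
      using B by (auto simp flip: borel_prod)
    then have "emeasure \<gamma> (UNIV \<times> B) = (\<integral>\<^sup>+\<omega>. indicator B (snd (fst \<omega>)) \<partial>Q)"
      by (simp add: ind f_def indicator_times)
    also have "\<dots> = (\<integral>\<^sup>+z. \<integral>\<^sup>+y. h (fst z, y) * indicator B (snd z) \<partial>\<mu>' \<partial>\<pi>)"
      by (subst IQ) simp_all
    also have "\<dots> \<le> (\<integral>\<^sup>+z. indicator (UNIV \<times> B) z \<partial>\<pi>)"
    proof (intro nn_integral_mono)
      fix z :: "'a \<times> 'a"
      show "(\<integral>\<^sup>+y. h (fst z, y) * indicator B (snd z) \<partial>\<mu>') \<le> indicator (UNIV \<times> B) z"
        using H1[of "fst z"] by (cases z; cases "snd z \<in> B") (auto simp: H_def)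
    qed
    also have "\<dots> = emeasure \<pi> (UNIV \<times> B)"
      using UB by (simp add: g)
    also have "\<dots> \<le> emeasure \<nu> B"
      using \<pi> B by (simp add: partial_plan_def)
    finally show ?thesis .
  qed
  have massQ: "emeasure \<gamma> UNIV = (\<integral>\<^sup>+z. H (fst z) \<partial>\<pi>)"
  proof -
    have "emeasure \<gamma> UNIV = (\<integral>\<^sup>+\<omega>. 1 \<partial>Q)"
      by (subst ind) simp_all
    also have "\<dots> = (\<integral>\<^sup>+z. H (fst z) \<partial>\<pi>)"
      by (subst IQ) (simp_all add: H_def)
    finally show ?thesis .
  qed
  \<comment> \<open>At x the density drops the fraction \<open>1 - H x\<close>. The first marginal
    of \<open>\<pi>\<close> is dominated by \<mu>, so the mass dropped from \<open>\<pi>\<close> is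
    at most the mass dropped from \<mu>, which is at most \<epsilon>.\<close>
  have lower: "ennreal \<alpha> \<le> emeasure \<gamma> UNIV + ennreal \<epsilon>"
  proof -
    have "(\<integral>\<^sup>+x. 1 - H x \<partial>\<mu>) = (\<integral>\<^sup>+x. 1 \<partial>\<mu>) - (\<integral>\<^sup>+x. H x \<partial>\<mu>)"
    proof (rule nn_integral_diff)
      have "(\<integral>\<^sup>+x. H x \<partial>\<mu>) \<le> (\<integral>\<^sup>+x. 1 \<partial>\<mu>)"
        by (intro nn_integral_mono H1)
      also have "\<dots> < \<infinity>" using \<mu>.emeasure_space_1 by simp
      finally show "(\<integral>\<^sup>+x. H x \<partial>\<mu>) \<noteq> \<infinity>" by simp
    qed (auto simp: H1)
    also have "\<dots> \<le> ennreal \<epsilon>"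
      using td \<mu>.emeasure_space_1
      by (simp add: transport_density_def H_def ennreal_minus_le_iff add.commute)
    finally have def: "(\<integral>\<^sup>+x. 1 - H x \<partial>\<mu>) \<le> ennreal \<epsilon>" .
    have "ennreal \<alpha> = (\<integral>\<^sup>+z. H (fst z) + (1 - H (fst z)) \<partial>\<pi>)"
      using mass_\<pi> by (simp add: H1 sp add_diff_inverse_ennreal)
    also have "\<dots> = emeasure \<gamma> UNIV + (\<integral>\<^sup>+z. 1 - H (fst z) \<partial>\<pi>)"
      unfolding massQ by (rule nn_integral_add) measurable
    also have "(\<integral>\<^sup>+z. 1 - H (fst z) \<partial>\<pi>) \<le> (\<integral>\<^sup>+x. 1 - H x \<partial>\<mu>)"
      by (rule partial_plan_fst_le[OF \<pi>]) (simp_all add: s)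
    finally show ?thesis
      using def by (meson add_left_mono order_trans)
  qed
  have upper: "emeasure \<gamma> UNIV \<le> ennreal \<alpha>"
  proof -
    have "emeasure \<gamma> UNIV \<le> (\<integral>\<^sup>+z. 1 \<partial>\<pi>)"
      unfolding massQ by (intro nn_integral_mono H1)
    then show ?thesis by (simp add: sp mass_\<pi>)
  qed
  define m where "m = enn2real (emeasure \<gamma> UNIV)"
  have m: "emeasure \<gamma> UNIV = ennreal m"
    using upper by (auto simp: m_def top_unique intro!: ennreal_enn2real[symmetric] le_less_trans[OF upper])
  have m_ge: "\<alpha> - \<epsilon> \<le> m"
    using lower \<open>0 \<le> \<epsilon>\<close> unfolding m by (simp add: m_def flip: ennreal_plus)
  have "partial_plan m \<mu>' \<nu> \<gamma>"
    using row col m by (simp add: partial_plan_def) (simp add: \<gamma>_def)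
  moreover have "(\<integral>\<^sup>+z. ennreal (dist (fst z) (snd z) powr p) \<partial>\<gamma>) \<le> ennreal ((D\<^sub>0 + D) powr p)"
  proof -
    have sQ [measurable_cong]: "sets Q = sets (\<pi> \<Otimes>\<^sub>M \<mu>')"
      by (simp add: Q_def)
    have "(\<integral>\<^sup>+z. ennreal (dist (fst z) (snd z) powr p) \<partial>\<gamma>) =
        (\<integral>\<^sup>+\<omega>. ennreal (dist (snd \<omega>) (snd (fst \<omega>)) powr p) \<partial>Q)"
      unfolding \<gamma>_def
      using borel_measurable_dist_powr[of p]
      by (subst nn_integral_distr) (auto simp only: measurable_distr_eq1 f, simp add: f_def)
    also have "\<dots> \<le> (\<integral>\<^sup>+\<omega>. ennreal ((dist (fst (fst \<omega>)) (snd (fst \<omega>)) + dist (fst (fst \<omega>)) (snd \<omega>)) powr p) \<partial>Q)"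
      using \<open>1 \<le> p\<close> by (intro nn_integral_mono ennreal_leI powr_mono2)
        (auto intro: order_trans[OF dist_triangle3] simp: add.commute dist_commute)
    also have "\<dots> \<le> ennreal ((D\<^sub>0 + D) powr p)"
    proof (rule nn_integral_powr_Minkowski)
      have "(\<integral>\<^sup>+\<omega>. ennreal (dist (fst (fst \<omega>)) (snd (fst \<omega>)) powr p) \<partial>Q) =
          (\<integral>\<^sup>+z. \<integral>\<^sup>+y. h (fst z, y) * ennreal (dist (fst z) (snd z) powr p) \<partial>\<mu>' \<partial>\<pi>)"
        by (subst IQ) simp_all
      also have "\<dots> \<le> (\<integral>\<^sup>+z. ennreal (dist (fst z) (snd z) powr p) \<partial>\<pi>)"
      proof (intro nn_integral_mono)
        fix z :: "'a \<times> 'a"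
        have "(\<integral>\<^sup>+y. h (fst z, y) * ennreal (dist (fst z) (snd z) powr p) \<partial>\<mu>') = H (fst z) * ennreal (dist (fst z) (snd z) powr p)"
          unfolding H_def by (rule nn_integral_multc) measurable
        also have "\<dots> \<le> 1 * ennreal (dist (fst z) (snd z) powr p)"
          by (intro mult_right_mono H1) auto
        finally show "(\<integral>\<^sup>+y. h (fst z, y) * ennreal (dist (fst z) (snd z) powr p) \<partial>\<mu>') \<le> ennreal (dist (fst z) (snd z) powr p)"
          by simp
      qed
      also note cost
      finally show "(\<integral>\<^sup>+\<omega>. ennreal (dist (fst (fst \<omega>)) (snd (fst \<omega>)) powr p) \<partial>Q) \<le> ennreal (D\<^sub>0 powr p)" .
      have "(\<integral>\<^sup>+\<omega>. ennreal (dist (fst (fst \<omega>)) (snd \<omega>) powr p) \<partial>Q) =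
          (\<integral>\<^sup>+z. \<integral>\<^sup>+y. h (fst z, y) * ennreal (dist (fst z) y powr p) \<partial>\<mu>' \<partial>\<pi>)"
        by (subst IQ) simp_all
      also have "\<dots> \<le> (\<integral>\<^sup>+x. \<integral>\<^sup>+y. h (x, y) * ennreal (dist x y powr p) \<partial>\<mu>' \<partial>\<mu>)"
        by (rule partial_plan_fst_le[OF \<pi>]) (simp_all add: s)
      also have "\<dots> \<le> ennreal (D powr p)"
        using td by (simp add: transport_density_def)
      finally show "(\<integral>\<^sup>+\<omega>. ennreal (dist (fst (fst \<omega>)) (snd \<omega>) powr p) \<partial>Q) \<le> ennreal (D powr p)" .
    qed (use assms in auto)
    finally show ?thesis .
  qed
  ultimately have "plan_within p m (D\<^sub>0 + D) \<mu>' \<nu>"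
    by (auto simp: plan_within_def)
  from plan_within_scale[OF this] show ?thesis
    using m_ge \<open>\<epsilon> \<le> \<alpha>\<close> by simp
qed

subsection \<open>Stability of RPW\<close>

definition prob_on :: "'a::euclidean_space set \<Rightarrow> 'a measure \<Rightarrow> bool" where
  "prob_on X \<mu> \<longleftrightarrow> prob_space \<mu> \<and> sets \<mu> = sets borel \<and> emeasure \<mu> X = 1"

lemma prob_on_compl:
  assumes "prob_on X \<mu>" "X \<in> sets borel"
  shows "emeasure \<mu> (- X) = 0"
proof -
  interpret prob_space \<mu> using assms by (simp add: prob_on_def)
  have s: "sets \<mu> = sets borel" using assms by (simp add: prob_on_def)
  have "space \<mu> = UNIV" using sets_eq_imp_space_eq[OF s] by simp
  then show ?thesis
    using assms emeasure_compl[of X \<mu>] emeasure_space_1 s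
    by (simp add: prob_on_def Compl_eq_Diff_UNIV)
qed

lemma prob_on_AE:
  assumes "prob_on X \<mu>" "X \<in> sets borel"
  shows "AE x in \<mu>. x \<in> X"
proof (rule AE_I[of _ _ "- X"])
  show "emeasure \<mu> (- X) = 0" by (rule prob_on_compl[OF assms])
qed (use assms in \<open>auto simp: prob_on_def\<close>)

text \<open>
  \<open>plan_cost\<close> is \<open>0\<close> on plans whose cost integral is infinite; the bounded support excludes this case.
\<close>
lemma partial_plan_cost_le:
  fixes X :: "'a::euclidean_space set"
  assumes X: "compact X" "diameter X \<le> 1" and \<mu>: "prob_on X \<mu>" and \<nu>: "prob_on X \<nu>"
    and \<gamma>: "partial_plan \<alpha> \<mu> \<nu> \<gamma>" and "0 \<le> p"
  shows "(\<integral>\<^sup>+z. ennreal (dist (fst z) (snd z) powr p) \<partial>\<gamma>) \<le> ennreal \<alpha>"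
proof -
  have [measurable]: "X \<in> sets borel"
    using X by (simp add: compact_imp_closed borel_closed)
  have g: "sets \<gamma> = sets borel" using \<gamma> by (simp add: partial_plan_def)
  have sp: "space \<gamma> = UNIV" using sets_eq_imp_space_eq[OF g] by simp
  have cX: "- X \<in> sets borel" by simp
  then have m: "(- X) \<times> UNIV \<in> sets \<gamma>" "UNIV \<times> (- X) \<in> sets \<gamma>"
    by (simp_all add: g flip: borel_prod)
  have "emeasure \<gamma> ((- X) \<times> UNIV) \<le> emeasure \<mu> (- X)" "emeasure \<gamma> (UNIV \<times> (- X)) \<le> emeasure \<nu> (- X)"
    using \<gamma> cX unfolding partial_plan_def by blast+
  then have "emeasure \<gamma> ((- X) \<times> UNIV) = 0" "emeasure \<gamma> (UNIV \<times> (- X)) = 0"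
    using prob_on_compl[OF \<mu>] prob_on_compl[OF \<nu>] by simp_all
  then have "AE z in \<gamma>. z \<notin> (- X) \<times> UNIV" "AE z in \<gamma>. z \<notin> UNIV \<times> (- X)"
    using m by (auto intro!: AE_not_in null_setsI)
  then have "AE z in \<gamma>. ennreal (dist (fst z) (snd z) powr p) \<le> 1"
  proof eventually_elim
    case (elim z)
    then have "fst z \<in> X" "snd z \<in> X" by (cases z; auto)+
    then have "dist (fst z) (snd z) \<le> 1"
      using diameter_bounded_bound[OF compact_imp_bounded[OF X(1)]] X(2) by force
    then show ?case using \<open>0 \<le> p\<close> by (simp add: powr_le1)
  qed
  then have "(\<integral>\<^sup>+z. ennreal (dist (fst z) (snd z) powr p) \<partial>\<gamma>) \<le> (\<integral>\<^sup>+z. 1 \<partial>\<gamma>)"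
    by (rule nn_integral_mono_AE)
  also have "\<dots> = ennreal \<alpha>"
    using \<gamma> by (simp add: sp partial_plan_def)
  finally show ?thesis .
qed

text \<open>Supplies a plan of full mass and, after scaling, of every smaller mass, so the infimum
  in \<open>partial_W\<close> ranges over a nonempty set.\<close>

lemma partial_plan_product:
  assumes "prob_on X \<mu>" "prob_on Y \<nu>"
  shows "partial_plan 1 \<mu> \<nu> (\<mu> \<Otimes>\<^sub>M \<nu>)"
proof -
  interpret \<mu>: prob_space \<mu> using assms by (simp add: prob_on_def)
  interpret \<nu>: prob_space \<nu> using assms by (simp add: prob_on_def)
  have s: "sets \<mu> = sets borel" "sets \<nu> = sets borel"
    using assms by (simp_all add: prob_on_def)
  have u: "emeasure \<mu> UNIV = 1" "emeasure \<nu> UNIV = 1"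
    using \<mu>.emeasure_space_1 \<nu>.emeasure_space_1 sets_eq_imp_space_eq[OF s(1)] sets_eq_imp_space_eq[OF s(2)]
    by simp_all
  have "sets (\<mu> \<Otimes>\<^sub>M \<nu>) = sets borel"
    unfolding borel_prod[symmetric] by (rule sets_pair_measure_cong[OF s])
  moreover have "emeasure (\<mu> \<Otimes>\<^sub>M \<nu>) (A \<times> B) = emeasure \<mu> A * emeasure \<nu> B"
    if "A \<in> sets borel" "B \<in> sets borel" for A B
    using that s by (simp add: \<nu>.emeasure_pair_measure_Times)
  from this[of UNIV UNIV] this[of UNIV] this[of _ UNIV] u
  have "emeasure (\<mu> \<Otimes>\<^sub>M \<nu>) UNIV = 1"
    "\<And>A. A \<in> sets borel \<Longrightarrow> emeasure (\<mu> \<Otimes>\<^sub>M \<nu>) (A \<times> UNIV) = emeasure \<mu> A"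
    "\<And>B. B \<in> sets borel \<Longrightarrow> emeasure (\<mu> \<Otimes>\<^sub>M \<nu>) (UNIV \<times> B) = emeasure \<nu> B"
    by simp_all
  ultimately show ?thesis
    by (simp add: partial_plan_def)
qed

lemma partial_W_le:
  assumes "plan_within p \<alpha> D \<mu> \<nu>" "0 \<le> D" "1 \<le> p"
  shows "partial_W p \<alpha> \<mu> \<nu> \<le> D"
proof -
  obtain \<gamma> where \<gamma>: "partial_plan \<alpha> \<mu> \<nu> \<gamma>"
    and cost: "(\<integral>\<^sup>+z. ennreal (dist (fst z) (snd z) powr p) \<partial>\<gamma>) \<le> ennreal (D powr p)"
    using assms by (auto simp: plan_within_def)
  have "partial_W p \<alpha> \<mu> \<nu> \<le> plan_cost p \<gamma>"
    unfolding partial_W_def using \<gamma>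
    by (intro cInf_lower bdd_belowI[of _ 0]) (auto simp: plan_cost_def)
  also have "\<dots> \<le> (D powr p) powr (1 / p)"
    unfolding plan_cost_def using enn2real_mono[OF cost] \<open>1 \<le> p\<close>
    by (intro powr_mono2) auto
  also have "\<dots> = D"
    using assms by (simp add: powr_powr)
  finally show ?thesis .
qed

text \<open>No minimiser is constructed: the strict inequality yields a plan by the definition of an
  infimum. Its cost integral is finite because the support is bounded, so \<open>enn2real\<close>
  loses nothing when the bound is carried back to the integral.\<close>

lemma plan_within_if_partial_W_less:
  fixes X :: "'a::euclidean_space set"
  assumes X: "compact X" "diameter X \<le> 1" and \<mu>: "prob_on X \<mu>" and \<nu>: "prob_on X \<nu>"
    and "1 \<le> p" "0 \<le> \<alpha>" "\<alpha> \<le> 1" and less: "partial_W p \<alpha> \<mu> \<nu> < D"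
  shows "plan_within p \<alpha> D \<mu> \<nu>"
proof -
  have "plan_within p 1 1 \<mu> \<nu>"
    using partial_plan_product[OF \<mu> \<nu>] partial_plan_cost_le[OF X \<mu> \<nu>, of 1 _ p] \<open>1 \<le> p\<close>
    by (auto simp: plan_within_def)
  then have "plan_within p \<alpha> 1 \<mu> \<nu>"
    using assms by (auto intro: plan_within_scale)
  then have "plan_cost p ` {\<gamma>. partial_plan \<alpha> \<mu> \<nu> \<gamma>} \<noteq> {}"
    by (auto simp: plan_within_def)
  from cInf_lessD[OF this less[unfolded partial_W_def]] obtain \<gamma> where
    \<gamma>: "partial_plan \<alpha> \<mu> \<nu> \<gamma>" and c: "plan_cost p \<gamma> < D" by auto
  define I where "I = (\<integral>\<^sup>+z. ennreal (dist (fst z) (snd z) powr p) \<partial>\<gamma>)"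
  have "I \<le> ennreal \<alpha>"
    unfolding I_def using \<open>1 \<le> p\<close> by (intro partial_plan_cost_le[OF X \<mu> \<nu> \<gamma>]) auto
  then have fin: "I < top" by (rule le_less_trans) simp
  have "enn2real I = (enn2real I powr (1 / p)) powr p"
    using \<open>1 \<le> p\<close> by (simp add: powr_powr)
  also have "\<dots> \<le> D powr p"
    using c \<open>1 \<le> p\<close> by (intro powr_mono2) (auto simp: plan_cost_def I_def)
  finally have "ennreal (enn2real I) \<le> ennreal (D powr p)"
    by (rule ennreal_leI)
  then have "I \<le> ennreal (D powr p)" using fin by simp
  with \<gamma> show ?thesis by (auto simp: plan_within_def I_def)
qed

text \<open>The null measure is a plan of mass 0. Hence 1 is always admissible in the definition of
  \<open>RPW\<close>, which makes that set nonempty and gives the bound 1.\<close>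

lemma partial_W_zero_le:
  assumes "0 \<le> k" "1 \<le> p"
  shows "partial_W p 0 \<mu> \<nu> \<le> k"
proof -
  have "plan_within p 0 k \<mu> \<nu>"
    unfolding plan_within_def
    by (intro exI[of _ "null_measure borel"]) (simp add: partial_plan_def)
  then show ?thesis using assms by (intro partial_W_le)
qed

text \<open>The admissible cost is linear in \<epsilon>, so losing further mass \<open>e\<close>
  raises it by exactly the \<open>k * e\<close> that the replacement may add: an admissible
  \<epsilon> becomes the admissible \<open>\<epsilon> + e\<close>.\<close>

lemma RPW_le_add:
  fixes X :: "'a::euclidean_space set"
  assumes X: "compact X" "diameter X \<le> 1" and \<mu>: "prob_on X \<mu>" and \<nu>: "prob_on X \<nu>"
    and "1 \<le> p" "0 \<le> k" "0 \<le> e"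
    and tr: "\<And>\<alpha> D. e \<le> \<alpha> \<Longrightarrow> \<alpha> \<le> 1 \<Longrightarrow> 0 \<le> D \<Longrightarrow> plan_within p \<alpha> D \<mu> \<nu>
               \<Longrightarrow> plan_within p (\<alpha> - e) (D + k * e) \<mu>' \<nu>'"
  shows "RPW p k \<mu>' \<nu>' \<le> RPW p k \<mu> \<nu> + e"
proof -
  have lower: "RPW p k \<mu>' \<nu>' \<le> \<epsilon>" if "\<epsilon> \<in> {0..1}" "partial_W p (1 - \<epsilon>) \<mu>' \<nu>' \<le> k * \<epsilon>" for \<epsilon>
    unfolding RPW_def using that by (intro cInf_lower bdd_belowI[of _ 0]) auto
  have "RPW p k \<mu>' \<nu>' - e \<le> RPW p k \<mu> \<nu>"
    unfolding RPW_def[of p k \<mu> \<nu>]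
  proof (rule cInf_greatest)
    have "1 \<in> {\<epsilon> \<in> {0..1}. partial_W p (1 - \<epsilon>) \<mu> \<nu> \<le> k * \<epsilon>}"
      using partial_W_zero_le[OF \<open>0 \<le> k\<close> \<open>1 \<le> p\<close>] by simp
    then show "{\<epsilon> \<in> {0..1}. partial_W p (1 - \<epsilon>) \<mu> \<nu> \<le> k * \<epsilon>} \<noteq> {}" by blast
    fix \<epsilon> assume "\<epsilon> \<in> {\<epsilon> \<in> {0..1}. partial_W p (1 - \<epsilon>) \<mu> \<nu> \<le> k * \<epsilon>}"
    then have \<epsilon>: "0 \<le> \<epsilon>" "\<epsilon> \<le> 1" "partial_W p (1 - \<epsilon>) \<mu> \<nu> \<le> k * \<epsilon>" by auto
    show "RPW p k \<mu>' \<nu>' - e \<le> \<epsilon>"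
    proof (cases "\<epsilon> + e \<le> 1")
      case False
      have "RPW p k \<mu>' \<nu>' \<le> 1"
        using partial_W_zero_le[OF \<open>0 \<le> k\<close> \<open>1 \<le> p\<close>] by (intro lower) auto
      with False show ?thesis by simp
    next
      case True
      have "partial_W p (1 - (\<epsilon> + e)) \<mu>' \<nu>' \<le> k * (\<epsilon> + e)"
      \<comment> \<open>The slack \<open>\<eta>\<close> turns the bound on an infimum into a strict
        one, from which an actual plan can be taken.\<close>
      proof (rule field_le_epsilon)
        fix \<eta> :: real assume "0 < \<eta>"
        have "plan_within p (1 - \<epsilon>) (k * \<epsilon> + \<eta>) \<mu> \<nu>"
          using \<epsilon> \<open>0 < \<eta>\<close> by (intro plan_within_if_partial_W_less[OF X \<mu> \<nu> \<open>1 \<le> p\<close>]) auto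
        then have "plan_within p (1 - \<epsilon> - e) (k * \<epsilon> + \<eta> + k * e) \<mu>' \<nu>'"
          using True \<epsilon> \<open>0 < \<eta>\<close> \<open>0 \<le> k\<close> by (intro tr) auto
        then have "partial_W p (1 - \<epsilon> - e) \<mu>' \<nu>' \<le> k * \<epsilon> + \<eta> + k * e"
          using \<epsilon> \<open>0 < \<eta>\<close> \<open>0 \<le> k\<close> \<open>0 \<le> e\<close> \<open>1 \<le> p\<close> by (intro partial_W_le) auto
        then show "partial_W p (1 - (\<epsilon> + e)) \<mu>' \<nu>' \<le> k * (\<epsilon> + e) + \<eta>"
          by (simp add: algebra_simps)
      qed
      then show ?thesis using lower[of "\<epsilon> + e"] True \<epsilon> \<open>0 \<le> e\<close> by simp
    qed
  qed
  then show ?thesis by simp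
qed

text \<open>Gluing replaces the first marginal only, so the plan is reversed before and after the
  second replacement. Each replacement loses mass \<open>e\<close> and adds cost
  \<open>k * e\<close>.\<close>

lemma RPW_le_add_transport:
  fixes X :: "'a::euclidean_space set"
  assumes X: "compact X" "diameter X \<le> 1"
    and on: "prob_on X \<mu>" "prob_on X \<nu>" "prob_on X \<mu>'" "prob_on X \<nu>'"
    and p: "1 \<le> p" "0 \<le> k" "0 \<le> e"
    and td: "transport_density p e (k * e) \<mu> \<mu>' h" "transport_density p e (k * e) \<nu> \<nu>' h'"
  shows "RPW p k \<mu>' \<nu>' \<le> RPW p k \<mu> \<nu> + 2 * e"
proof (rule RPW_le_add[OF X on(1,2)])
  fix \<alpha> D :: real assume a: "2 * e \<le> \<alpha>" "\<alpha> \<le> 1" "0 \<le> D" "plan_within p \<alpha> D \<mu> \<nu>"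
  have on': "prob_space M" "sets M = sets borel" if "prob_on X M" for M
    using that by (simp_all add: prob_on_def)
  have "plan_within p (\<alpha> - e) (D + k * e) \<mu>' \<nu>"
    using a p by (intro plan_within_glue[OF _ td(1)] on' on) auto
  then have "plan_within p (\<alpha> - e) (D + k * e) \<nu> \<mu>'"
    by (rule plan_within_swap)
  then have "plan_within p (\<alpha> - e - e) (D + k * e + k * e) \<nu>' \<mu>'"
    using a p by (intro plan_within_glue[OF _ td(2)] on' on) auto
  then have "plan_within p (\<alpha> - e - e) (D + k * e + k * e) \<mu>' \<nu>'"
    by (rule plan_within_swap)
  then show "plan_within p (\<alpha> - 2 * e) (D + k * (2 * e)) \<mu>' \<nu>'"
    by (simp add: algebra_simps)
qed (use p in auto)

text \<open>A transport density read backwards couples the same two measures with the same loss and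
  cost, so one pair of densities gives both inequalities.\<close>

lemma RPW_diff_le_transport:
  fixes X :: "'a::euclidean_space set"
  assumes X: "compact X" "diameter X \<le> 1"
    and on: "prob_on X \<mu>" "prob_on X \<nu>" "prob_on X \<mu>'" "prob_on X \<nu>'"
    and p: "1 \<le> p" "0 \<le> k" "0 \<le> e"
    and td: "transport_density p e (k * e) \<mu> \<mu>' h" "transport_density p e (k * e) \<nu> \<nu>' h'"
  shows "\<bar>RPW p k \<mu> \<nu> - RPW p k \<mu>' \<nu>'\<bar> \<le> 2 * e"
proof -
  have on': "prob_space M" "sets M = sets borel" if "prob_on X M" for M
    using that by (simp_all add: prob_on_def)
  have "RPW p k \<mu>' \<nu>' \<le> RPW p k \<mu> \<nu> + 2 * e"
    by (rule RPW_le_add_transport[OF X on p td])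
  moreover have "RPW p k \<mu> \<nu> \<le> RPW p k \<mu>' \<nu>' + 2 * e"
    by (rule RPW_le_add_transport[OF X on(3,4,1,2) p])
      (rule transport_density_swap[OF td(1)] transport_density_swap[OF td(2)]; simp add: on' on)+
  ultimately show ?thesis by simp
qed

subsection \<open>Couplings that are constant on cells\<close>

lemma nn_integral_cells:
  fixes F :: "'k \<Rightarrow> ennreal"
  assumes "finite_measure M" "finite S" and C: "\<And>s. s \<in> S \<Longrightarrow> {x. q x = s} \<in> sets M"
  shows "(\<integral>\<^sup>+x. (if q x \<in> S then F (q x) else 0) \<partial>M) = (\<Sum>s\<in>S. F s * ennreal (measure M {x. q x = s}))"
proof -
  interpret finite_measure M by fact
  have "(if q x \<in> S then F (q x) else 0) = (\<Sum>s\<in>S. F s * indicator {x. q x = s} x)" for x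
  proof -
    have "(\<Sum>s\<in>S. F s * indicator {x. q x = s} x) = (\<Sum>s\<in>S. if q x = s then F s else 0)"
      by (rule sum.cong) (auto simp: indicator_def)
    then show ?thesis using \<open>finite S\<close> by simp
  qed
  then have "(\<integral>\<^sup>+x. (if q x \<in> S then F (q x) else 0) \<partial>M) = (\<integral>\<^sup>+x. (\<Sum>s\<in>S. F s * indicator {x. q x = s} x) \<partial>M)"
    by simp
  also have "\<dots> = (\<Sum>s\<in>S. \<integral>\<^sup>+x. F s * indicator {x. q x = s} x \<partial>M)"
    using C by (intro nn_integral_sum) simp
  also have "\<dots> = (\<Sum>s\<in>S. F s * ennreal (measure M {x. q x = s}))"
    using C by (intro sum.cong) (auto simp: nn_integral_cmult_indicator emeasure_eq_measure)
  finally show ?thesis .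
qed

text \<open>Between two cells the mass \<open>G s t\<close> is spread as the product of the measures
  conditioned on these cells. This has a density that is constant on products of cells, even when
  \<mu> has atoms.\<close>

lemma transport_density_of_cell_plan:
  fixes \<mu> \<mu>' :: "'a::euclidean_space measure" and q :: "'a \<Rightarrow> 'k"
  assumes "prob_space \<mu>" "prob_space \<mu>'" and s: "sets \<mu> = sets borel" "sets \<mu>' = sets borel"
    and fin: "finite S" and C: "\<And>s. s \<in> S \<Longrightarrow> {x. q x = s} \<in> sets borel"
    and plan: "cell_plan S c (\<lambda>s. measure \<mu> {x. q x = s}) (\<lambda>s. measure \<mu>' {x. q x = s}) G"
    and w: "\<And>x y. dist x y powr p \<le> w (q x) (q y)"
    and mass: "1 - (\<Sum>s\<in>S. \<Sum>t\<in>S. G s t) \<le> \<epsilon>"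
    and cost: "(\<Sum>s\<in>S. \<Sum>t\<in>S. G s t * w s t) \<le> D powr p"
  obtains h where "transport_density p \<epsilon> D \<mu> \<mu>' h"
proof -
  interpret \<mu>: prob_space \<mu> by fact
  interpret \<mu>': prob_space \<mu>' by fact
  define a where "a s = measure \<mu> {x. q x = s}" for s
  define b where "b s = measure \<mu>' {x. q x = s}" for s
  have fm: "finite_measure \<mu>" "finite_measure \<mu>'" by unfold_locales
  have C\<mu>: "\<And>s. s \<in> S \<Longrightarrow> {x. q x = s} \<in> sets \<mu>" and C\<mu>': "\<And>s. s \<in> S \<Longrightarrow> {x. q x = s} \<in> sets \<mu>'"
    using C s by auto
  have ab: "0 \<le> a s" "0 \<le> b s" for s by (simp_all add: a_def b_def)
  have G0: "0 \<le> G s t" if "s \<in> S" "t \<in> S" for s t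
    using plan that by (simp add: cell_plan_def)
  have row: "(\<Sum>t\<in>S. G s t) \<le> a s" if "s \<in> S" for s
    using plan that by (simp add: cell_plan_def a_def)
  have col: "(\<Sum>s\<in>S. G s t) \<le> b t" if "t \<in> S" for t
    using plan that by (simp add: cell_plan_def b_def)
  \<comment> \<open>These bounds make division by empty cells harmless: if a cell has mass 0, then
    \<open>G\<close> vanishes there too.\<close>
  have Ga: "G s t \<le> a s" and Gb: "G s t \<le> b t" if "s \<in> S" "t \<in> S" for s t
    using that fin G0 order_trans[OF member_le_sum row] order_trans[OF member_le_sum col]
    by (metis (no_types, lifting) DiffD1)+
  define g where "g s t = ennreal (G s t / (a s * b t))" for s t
  have gb: "g s t * ennreal (b t) = ennreal (G s t / a s)" if "s \<in> S" "t \<in> S" for s t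
    using G0[OF that] Gb[OF that] ab[of s] ab[of t] by (cases "b t = 0") (auto simp: g_def simp flip: ennreal_mult)
  have ga: "g s t * ennreal (a s) = ennreal (G s t / b t)" if "s \<in> S" "t \<in> S" for s t
    using G0[OF that] Ga[OF that] ab[of s] ab[of t] by (cases "a s = 0") (auto simp: g_def simp flip: ennreal_mult)
  have gab: "ennreal (G s t / a s) * ennreal (a s) = ennreal (G s t)" if "s \<in> S" "t \<in> S" for s t
    using G0[OF that] Ga[OF that] ab[of s] by (cases "a s = 0") (auto simp flip: ennreal_mult)
  define h where "h z = (if q (fst z) \<in> S then if q (snd z) \<in> S then g (q (fst z)) (q (snd z)) else 0 else 0)" for z
  have h_meas: "h \<in> borel_measurable borel"
  proof -
    have "h = (\<lambda>z. \<Sum>s\<in>S. \<Sum>t\<in>S. g s t * indicator ({x. q x = s} \<times> {x. q x = t}) z)"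
    proof
      fix z
      have "(\<Sum>s\<in>S. \<Sum>t\<in>S. g s t * indicator ({x. q x = s} \<times> {x. q x = t}) z) =
          (\<Sum>s\<in>S. if q (fst z) = s then (\<Sum>t\<in>S. if q (snd z) = t then g s t else 0) else 0)"
        by (cases z) (auto intro!: sum.cong simp: indicator_def)
      also have "\<dots> = h z" using fin by (simp add: h_def)
      finally show "h z = (\<Sum>s\<in>S. \<Sum>t\<in>S. g s t * indicator ({x. q x = s} \<times> {x. q x = t}) z)" ..
    qed
    moreover have "{x. q x = s} \<times> {x. q x = t} \<in> sets borel" if "s \<in> S" "t \<in> S" for s t
      using C[OF that(1)] C[OF that(2)] by (simp flip: borel_prod)
    ultimately show ?thesis
      by (auto intro!: borel_measurable_sum)
  qed
  have h_Pair: "h (x, y) = (if q x \<in> S then if q y \<in> S then g (q x) (q y) else 0 else 0)" for x y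
    by (simp only: h_def fst_conv snd_conv)
  have row_int: "(\<integral>\<^sup>+y. h (x, y) \<partial>\<mu>') = (if q x \<in> S then ennreal (\<Sum>t\<in>S. G (q x) t / a (q x)) else 0)" for x
  proof (cases "q x \<in> S")
    case True
    then have "(\<integral>\<^sup>+y. h (x, y) \<partial>\<mu>') = (\<Sum>t\<in>S. g (q x) t * ennreal (b t))"
      unfolding b_def using nn_integral_cells[OF fm(2) fin C\<mu>', of "g (q x)"] by (simp add: h_Pair)
    also have "\<dots> = (\<Sum>t\<in>S. ennreal (G (q x) t / a (q x)))"
      using True by (simp add: gb)
    also have "\<dots> = ennreal (\<Sum>t\<in>S. G (q x) t / a (q x))"
      using True G0 ab by (intro sum_ennreal) auto
    finally show ?thesis using True by simp
  qed (simp add: h_Pair)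
  have "(\<integral>\<^sup>+y. h (x, y) \<partial>\<mu>') \<le> 1" for x
    unfolding row_int using row[of "q x"] ab[of "q x"]
    by (auto simp: sum_divide_distrib[symmetric] divide_le_eq_1)
  moreover have "(\<integral>\<^sup>+x. h (x, y) \<partial>\<mu>) \<le> 1" for y
  proof (cases "q y \<in> S")
    case True
    then have "(\<integral>\<^sup>+x. h (x, y) \<partial>\<mu>) = (\<Sum>s\<in>S. g s (q y) * ennreal (a s))"
      unfolding a_def using nn_integral_cells[OF fm(1) fin C\<mu>, of "\<lambda>s. g s (q y)"]
      by (simp add: h_Pair cong: if_cong)
    also have "\<dots> = (\<Sum>s\<in>S. ennreal (G s (q y) / b (q y)))"
      using True by (simp add: ga)
    also have "\<dots> = ennreal (\<Sum>s\<in>S. G s (q y) / b (q y))"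
      using True G0 ab by (intro sum_ennreal) auto
    also have "\<dots> \<le> 1"
      using col[OF True] ab[of "q y"] by (auto simp: sum_divide_distrib[symmetric] divide_le_eq_1)
    finally show ?thesis .
  qed (simp add: h_Pair cong: if_cong)
  moreover have "1 \<le> (\<integral>\<^sup>+x. \<integral>\<^sup>+y. h (x, y) \<partial>\<mu>' \<partial>\<mu>) + ennreal \<epsilon>"
  proof -
    have "(\<integral>\<^sup>+x. \<integral>\<^sup>+y. h (x, y) \<partial>\<mu>' \<partial>\<mu>) = (\<Sum>s\<in>S. ennreal (\<Sum>t\<in>S. G s t / a s) * ennreal (a s))"
      unfolding row_int a_def
      using nn_integral_cells[OF fm(1) fin C\<mu>, of "\<lambda>s. ennreal (\<Sum>t\<in>S. G s t / measure \<mu> {x. q x = s})"] by simp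
    also have "\<dots> = (\<Sum>s\<in>S. \<Sum>t\<in>S. ennreal (G s t))"
    proof (rule sum.cong)
      fix s assume s: "s \<in> S"
      have "ennreal (\<Sum>t\<in>S. G s t / a s) * ennreal (a s) = (\<Sum>t\<in>S. ennreal (G s t / a s) * ennreal (a s))"
      proof -
        have "(\<Sum>t\<in>S. ennreal (G s t / a s)) = ennreal (\<Sum>t\<in>S. G s t / a s)"
          using s G0 ab by (intro sum_ennreal) auto
        then show ?thesis by (metis (no_types) sum_distrib_right)
      qed
      also have "\<dots> = (\<Sum>t\<in>S. ennreal (G s t))"
        using s by (simp add: gab)
      finally show "ennreal (\<Sum>t\<in>S. G s t / a s) * ennreal (a s) = (\<Sum>t\<in>S. ennreal (G s t))" .
    qed simp
    also have "\<dots> = ennreal (\<Sum>s\<in>S. \<Sum>t\<in>S. G s t)"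
      using G0 by (simp add: sum_ennreal sum_nonneg)
    finally have eq: "(\<integral>\<^sup>+x. \<integral>\<^sup>+y. h (x, y) \<partial>\<mu>' \<partial>\<mu>) = ennreal (\<Sum>s\<in>S. \<Sum>t\<in>S. G s t)" .
    \<comment> \<open>A negative \<epsilon> is possible here and is truncated to 0 by
      \<open>ennreal\<close>, hence the maximum.\<close>
    have "ennreal 1 \<le> ennreal ((\<Sum>s\<in>S. \<Sum>t\<in>S. G s t) + max \<epsilon> 0)"
      using mass by (intro ennreal_leI) auto
    also have "\<dots> = ennreal (\<Sum>s\<in>S. \<Sum>t\<in>S. G s t) + ennreal (max \<epsilon> 0)"
      using G0 by (intro ennreal_plus sum_nonneg) auto
    also have "ennreal (max \<epsilon> 0) = ennreal \<epsilon>"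
      by (simp add: max_def ennreal_neg)
    finally show ?thesis by (simp add: eq)
  qed
  moreover have "(\<integral>\<^sup>+x. \<integral>\<^sup>+y. h (x, y) * ennreal (dist x y powr p) \<partial>\<mu>' \<partial>\<mu>) \<le> ennreal (D powr p)"
  proof -
    have w0: "0 \<le> w (q x) (q y)" for x y
      using w[of x y] by (meson order_trans powr_ge_zero)
    \<comment> \<open>\<open>w\<close> is controlled only at keys that are attained by points. A key
      that is not attained has an empty cell, so \<open>G\<close> vanishes there.\<close>
    have ww: "G s t = 0 \<or> 0 \<le> w s t" if "s \<in> S" "t \<in> S" for s t
    proof (cases "\<exists>x y. q x = s \<and> q y = t")
      case True
      then show ?thesis using w0 by blast
    next
      case False
      then have "a s = 0 \<or> b t = 0" by (auto simp: a_def b_def)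
      then have "G s t = 0" using Ga[OF that] Gb[OF that] G0[OF that] by auto
      then show ?thesis by simp
    qed
    have Gw0: "0 \<le> G s t * w s t" if "s \<in> S" "t \<in> S" for s t
      using ww[OF that] G0[OF that] by auto
    have "(\<integral>\<^sup>+x. \<integral>\<^sup>+y. h (x, y) * ennreal (dist x y powr p) \<partial>\<mu>' \<partial>\<mu>) \<le>
        (\<integral>\<^sup>+x. \<integral>\<^sup>+y. (if q x \<in> S then if q y \<in> S then g (q x) (q y) * ennreal (w (q x) (q y)) else 0 else 0) \<partial>\<mu>' \<partial>\<mu>)"
      by (intro nn_integral_mono) (auto simp: h_Pair intro!: mult_left_mono ennreal_leI w)
    also have "\<dots> = (\<integral>\<^sup>+x. (if q x \<in> S then \<integral>\<^sup>+y. (if q y \<in> S then g (q x) (q y) * ennreal (w (q x) (q y)) else 0) \<partial>\<mu>' else 0) \<partial>\<mu>)"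
      by (intro nn_integral_cong) auto
    also have "\<dots> = (\<Sum>s\<in>S. (\<integral>\<^sup>+y. (if q y \<in> S then g s (q y) * ennreal (w s (q y)) else 0) \<partial>\<mu>') * ennreal (a s))"
      unfolding a_def by (rule nn_integral_cells[OF fm(1) fin C\<mu>,
          of "\<lambda>s. \<integral>\<^sup>+y. (if q y \<in> S then g s (q y) * ennreal (w s (q y)) else 0) \<partial>\<mu>'"])
    also have "\<dots> = (\<Sum>s\<in>S. (\<Sum>t\<in>S. g s t * ennreal (w s t) * ennreal (b t)) * ennreal (a s))"
      unfolding b_def by (subst nn_integral_cells[OF fm(2) fin C\<mu>', of "\<lambda>t. g _ t * ennreal (w _ t)"]) auto
    also have "\<dots> = (\<Sum>s\<in>S. \<Sum>t\<in>S. ennreal (G s t * w s t))"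
    proof (rule sum.cong)
      fix s assume s: "s \<in> S"
      have "g s t * ennreal (w s t) * ennreal (b t) * ennreal (a s) = ennreal (G s t * w s t)" if t: "t \<in> S" for t
      proof -
        have "g s t * ennreal (w s t) * ennreal (b t) * ennreal (a s) = g s t * ennreal (b t) * ennreal (a s) * ennreal (w s t)"
          by (simp add: ac_simps)
        also have "\<dots> = ennreal (G s t) * ennreal (w s t)"
          using s t by (simp add: gb gab)
        also have "\<dots> = ennreal (G s t * w s t)"
          using ww[OF s t] G0[OF s t] by (auto simp: ennreal_mult)
        finally show ?thesis .
      qed
      then show "(\<Sum>t\<in>S. g s t * ennreal (w s t) * ennreal (b t)) * ennreal (a s) = (\<Sum>t\<in>S. ennreal (G s t * w s t))"
        by (simp add: sum_distrib_right)
    qed simp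
    also have "\<dots> = ennreal (\<Sum>s\<in>S. \<Sum>t\<in>S. G s t * w s t)"
      using Gw0 by (simp add: sum_ennreal sum_nonneg)
    also have "\<dots> \<le> ennreal (D powr p)"
      by (rule ennreal_leI[OF cost])
    finally show ?thesis .
  qed
  ultimately have "transport_density p \<epsilon> D \<mu> \<mu>' h"
    using h_meas by (simp add: transport_density_def)
  then show ?thesis by (rule that)
qed

subsection \<open>Dyadic cells\<close>

text \<open>The key names a half-open cube of side 2^-j. Restriction to \<open>Basis\<close> fixes
  its values elsewhere, so that equal keys mean equal floors and the keys of a bounded set fit into
  a finite product.\<close>

definition dyadic_key :: "nat \<Rightarrow> 'a::euclidean_space \<Rightarrow> 'a \<Rightarrow> int" where
  "dyadic_key j x = (\<lambda>b\<in>Basis. \<lfloor>2 ^ j * (x \<bullet> b)\<rfloor>)"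

definition coarse_key :: "nat \<Rightarrow> nat \<Rightarrow> ('a::euclidean_space \<Rightarrow> int) \<Rightarrow> 'a \<Rightarrow> int" where
  "coarse_key J j s = (\<lambda>b\<in>Basis. s b div 2 ^ (J - j))"

text \<open>An l1 bound for the distance of any two points of the two cells, depending on the keys
  alone; the summand 1 covers their positions inside the cells.\<close>

definition key_dist :: "nat \<Rightarrow> ('a::euclidean_space \<Rightarrow> int) \<Rightarrow> ('a \<Rightarrow> int) \<Rightarrow> real" where
  "key_dist J s t = (\<Sum>b\<in>Basis. (\<bar>real_of_int (s b - t b)\<bar> + 1) / 2 ^ J)"

text \<open>Floors nest: dividing by a positive integer commutes with rounding down. The cell of a
  point at every coarser level is therefore a function of its finest key.\<close>

lemma coarse_key_dyadic_key:
  assumes "j \<le> J"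
  shows "coarse_key J j (dyadic_key J x) = dyadic_key j x"
proof -
  have "\<lfloor>2 ^ J * (x \<bullet> b)\<rfloor> div 2 ^ (J - j) = \<lfloor>2 ^ j * (x \<bullet> b)\<rfloor>" for b
  proof -
    have "(2::real) ^ J = 2 ^ j * 2 ^ (J - j)"
      using assms by (simp flip: power_add)
    then have "\<lfloor>2 ^ j * (x \<bullet> b)\<rfloor> = \<lfloor>(2 ^ J * (x \<bullet> b)) / real_of_int (2 ^ (J - j))\<rfloor>"
      by simp
    also have "\<dots> = \<lfloor>2 ^ J * (x \<bullet> b)\<rfloor> div 2 ^ (J - j)"
      by (rule floor_divide_real_eq_div) simp
    finally show ?thesis ..
  qed
  then show ?thesis
    by (auto simp: coarse_key_def dyadic_key_def)
qed

lemma coarse_key_image: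
  "j \<le> J \<Longrightarrow> coarse_key J j ` dyadic_key J ` X = dyadic_key j ` X"
  by (simp add: image_image coarse_key_dyadic_key)

lemma coarse_key_nested:
  assumes "j < J" "coarse_key J (Suc j) s = coarse_key J (Suc j) t"
  shows "coarse_key J j s = coarse_key J j t"
proof -
  have "J - j = Suc (J - Suc j)" using assms by simp
  then have "z div 2 ^ (J - j) = z div 2 ^ (J - Suc j) div 2" for z :: int
    using zdiv_zmult2_eq[of 2 z "2 ^ (J - Suc j)"] by (simp only: power_Suc2 zero_le_numeral simp_thms)
  moreover have "s b div 2 ^ (J - Suc j) = t b div 2 ^ (J - Suc j)" if "b \<in> Basis" for b
    using fun_cong[OF assms(2), of b] that by (simp add: coarse_key_def)
  ultimately show ?thesis
    by (auto simp: coarse_key_def)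
qed

lemma dist_le_key_dist:
  "dist x y \<le> key_dist J (dyadic_key J x) (dyadic_key J y)"
proof -
  have "dist x y \<le> (\<Sum>b\<in>Basis. \<bar>(x - y) \<bullet> b\<bar>)"
    unfolding dist_norm by (rule norm_le_l1)
  also have "\<dots> \<le> key_dist J (dyadic_key J x) (dyadic_key J y)"
    unfolding key_dist_def
  proof (rule sum_mono)
    fix b :: 'a assume b: "b \<in> Basis"
    have "2 ^ J * \<bar>(x - y) \<bullet> b\<bar> = \<bar>2 ^ J * (x \<bullet> b) - 2 ^ J * (y \<bullet> b)\<bar>"
      by (simp add: inner_diff_left abs_mult flip: right_diff_distrib)
    also have "\<dots> \<le> \<bar>real_of_int (\<lfloor>2 ^ J * (x \<bullet> b)\<rfloor> - \<lfloor>2 ^ J * (y \<bullet> b)\<rfloor>)\<bar> + 1"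
      by linarith
    finally show "\<bar>(x - y) \<bullet> b\<bar> \<le> (\<bar>real_of_int (dyadic_key J x b - dyadic_key J y b)\<bar> + 1) / 2 ^ J"
      using b by (simp add: dyadic_key_def field_simps)
  qed
  finally show ?thesis .
qed

lemma key_dist_le:
  fixes s t :: "'a::euclidean_space \<Rightarrow> int"
  assumes "j \<le> J" "coarse_key J j s = coarse_key J j t"
  shows "key_dist J s t \<le> DIM('a) / 2 ^ j"
proof -
  have "key_dist J s t \<le> (\<Sum>b\<in>(Basis :: 'a set). 1 / 2 ^ j)"
    unfolding key_dist_def
  proof (rule sum_mono)
    fix b :: 'a assume b: "b \<in> Basis"
    define m :: int where "m = 2 ^ (J - j)"
    have m: "m > 0" by (simp add: m_def)
    have eq: "s b div m = t b div m"
      using fun_cong[OF assms(2), of b] b by (simp add: coarse_key_def m_def)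
    have "s b = m * (s b div m) + s b mod m" "t b = m * (s b div m) + t b mod m"
      using mult_div_mod_eq[of m "s b"] mult_div_mod_eq[of m "t b"] eq by simp_all
    moreover have "0 \<le> s b mod m" "s b mod m < m" "0 \<le> t b mod m" "t b mod m < m"
      using m by auto
    \<comment> \<open>Two integers in the same block of length \<open>m\<close> differ by at most
      \<open>m - 1\<close>, which leaves exactly the room for the summand 1 in
      \<open>key_dist\<close>.\<close>
    ultimately have "\<bar>s b - t b\<bar> + 1 \<le> m" by linarith
    then have "real_of_int (\<bar>s b - t b\<bar> + 1) \<le> real_of_int m"
      by (simp only: of_int_le_iff)
    then have "(\<bar>real_of_int (s b - t b)\<bar> + 1) / 2 ^ J \<le> 2 ^ (J - j) / 2 ^ J"
      by (intro divide_right_mono) (simp_all add: m_def)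
    also have "\<dots> = 1 / 2 ^ j"
      using \<open>j \<le> J\<close> by (simp add: power_diff)
    finally show "(\<bar>real_of_int (s b - t b)\<bar> + 1) / 2 ^ J \<le> 1 / 2 ^ j" .
  qed
  then show ?thesis by simp
qed

lemma dyadic_cell_measurable:
  fixes s :: "'a::euclidean_space \<Rightarrow> int"
  shows "{x. dyadic_key J x = s} \<in> sets borel"
proof (cases "s \<in> extensional Basis")
  case True
  have "{x. dyadic_key J x = s} = {x. \<forall>b\<in>Basis. \<lfloor>2 ^ J * (x \<bullet> b)\<rfloor> = s b}"
  proof (intro Collect_cong iffI)
    fix x :: 'a
    show "\<forall>b\<in>Basis. \<lfloor>2 ^ J * (x \<bullet> b)\<rfloor> = s b" if "dyadic_key J x = s"
      using that by (auto simp: dyadic_key_def)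
    show "dyadic_key J x = s" if "\<forall>b\<in>Basis. \<lfloor>2 ^ J * (x \<bullet> b)\<rfloor> = s b"
      using that True by (auto simp: dyadic_key_def extensional_def)
  qed
  moreover have "{x :: 'a. \<forall>b\<in>Basis. \<lfloor>2 ^ J * (x \<bullet> b)\<rfloor> = s b} \<in> sets borel"
    by measurable
  ultimately show ?thesis by simp
next
  case False
  then have "{x. dyadic_key J x = s} = {}"
    by (auto simp: dyadic_key_def)
  then show ?thesis by simp
qed

lemma dyadic_key_image:
  fixes X :: "'a::euclidean_space set"
  assumes "bounded X" "diameter X \<le> 1"
  shows "finite (dyadic_key j ` X)" "card (dyadic_key j ` X) \<le> 5 ^ DIM('a) * 2 ^ (j * DIM('a))"
proof -
  have "finite (dyadic_key j ` X) \<and> card (dyadic_key j ` X) \<le> 5 ^ DIM('a) * 2 ^ (j * DIM('a))"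
  proof (cases "X = {}")
    case False
    then obtain x\<^sub>0 where x0: "x\<^sub>0 \<in> X" by auto
    define m where "m b = \<lfloor>2 ^ j * (x\<^sub>0 \<bullet> b)\<rfloor>" for b
    \<comment> \<open>Coordinates of points in \<open>X\<close> differ by at most 1, so their scaled
      floors differ by at most 2^j + 1. Such an interval has 2 * 2^j + 3 integers, at most 5 * 2^j;
      this is the origin of the factor 5^d.\<close>
    define B where "B b = {m b - (2 ^ j + 1)..m b + (2 ^ j + 1)}" for b
    have sub: "dyadic_key j ` X \<subseteq> Pi\<^sub>E Basis B"
    proof (intro image_subsetI PiE_I)
      fix x b :: 'a assume x: "x \<in> X" and b: "b \<in> Basis"
      have "\<bar>(x - x\<^sub>0) \<bullet> b\<bar> \<le> norm (x - x\<^sub>0)"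
        using b by (rule Basis_le_norm)
      also have "\<dots> \<le> 1"
        using diameter_bounded_bound[OF assms(1) x x0] assms(2) by (simp add: dist_norm)
      finally have "\<bar>2 ^ j * ((x - x\<^sub>0) \<bullet> b)\<bar> \<le> 2 ^ j"
        by (simp add: abs_mult mult_left_le)
      then have "\<bar>2 ^ j * (x \<bullet> b) - 2 ^ j * (x\<^sub>0 \<bullet> b)\<bar> \<le> real_of_int (2 ^ j)"
        by (simp add: inner_diff_left right_diff_distrib)
      then have "\<bar>\<lfloor>2 ^ j * (x \<bullet> b)\<rfloor> - m b\<bar> \<le> 2 ^ j + 1"
        unfolding m_def by linarith
      then show "dyadic_key j x b \<in> B b"
        using b by (auto simp: dyadic_key_def B_def)
    qed (simp add: dyadic_key_def)
    have finB: "finite (Pi\<^sub>E Basis B)" by (intro finite_PiE) (auto simp: B_def)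
    have "card (dyadic_key j ` X) \<le> card (Pi\<^sub>E Basis B)"
      by (rule card_mono[OF finB sub])
    also have "\<dots> = (\<Prod>b\<in>(Basis :: 'a set). card (B b))"
      by (rule card_PiE) simp
    also have "\<dots> \<le> (\<Prod>b\<in>(Basis :: 'a set). 5 * 2 ^ j)"
    proof (rule prod_mono)
      fix b :: 'a
      have "card (B b) = nat (2 * 2 ^ j + 3)"
        by (simp add: B_def)
      also have "\<dots> \<le> nat (5 * 2 ^ j)"
        by (intro nat_mono) simp
      also have "\<dots> = 5 * 2 ^ j" by (simp add: nat_mult_distrib nat_power_eq)
      finally show "0 \<le> card (B b) \<and> card (B b) \<le> 5 * 2 ^ j" by simp
    qed
    also have "\<dots> = 5 ^ DIM('a) * 2 ^ (j * DIM('a))"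
      by (simp add: power_mult_distrib power_mult)
    finally show ?thesis using finite_subset[OF sub finB] by simp
  qed simp
  then show "finite (dyadic_key j ` X)" "card (dyadic_key j ` X) \<le> 5 ^ DIM('a) * 2 ^ (j * DIM('a))"
    by auto
qed

subsection \<open>Concentration of empirical cell masses\<close>

lemma measure_empirical:
  assumes "n > 0" "A \<in> sets borel"
  shows "measure (empirical x n) A = (\<Sum>i<n. indicator A (x i)) / real n"
proof -
  let ?U = "uniform_count_measure {..<n}"
  have m: "x \<in> measurable ?U borel"
    by (simp add: measurable_def space_uniform_count_measure sets_uniform_count_measure)
  have "measure (empirical x n) A = measure ?U (x -` A \<inter> {..<n})"
    using assms m by (simp add: empirical_def measure_distr space_uniform_count_measure)
  also have "\<dots> = real (card (x -` A \<inter> {..<n})) / real n"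
    by (subst measure_uniform_count_measure) auto
  also have "real (card (x -` A \<inter> {..<n})) = (\<Sum>i<n. indicator A (x i))"
    using sum.inter_restrict[of "{..<n}" "\<lambda>_. 1 :: real" "x -` A"]
    by (simp add: indicator_def Int_commute vimage_def)
  finally show ?thesis .
qed

lemma prob_on_empirical:
  assumes "n > 0" "X \<in> sets borel" "\<And>i. i < n \<Longrightarrow> x i \<in> X"
  shows "prob_on X (empirical x n)"
proof -
  let ?U = "uniform_count_measure {..<n}"
  have m: "x \<in> measurable ?U borel"
    by (simp add: measurable_def space_uniform_count_measure sets_uniform_count_measure)
  have U: "prob_space ?U"
    using assms(1) by (intro prob_space_uniform_count_measure) auto
  then interpret P: prob_space "empirical x n"
    unfolding empirical_def by (rule prob_space.prob_space_distr[OF _ m])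
  have "measure (empirical x n) X = 1"
    using assms by (simp add: measure_empirical)
  moreover have "sets (empirical x n) = sets borel" by (simp add: empirical_def)
  ultimately show ?thesis
    by (simp add: prob_on_def P.prob_space_axioms P.emeasure_eq_measure)
qed

lemma indep_vars_PiM_components:
  assumes "prob_space M" "I \<noteq> {}"
  shows "prob_space.indep_vars (Pi\<^sub>M I (\<lambda>_. M)) (\<lambda>_. M) (\<lambda>i x. x i) I"
proof -
  interpret P: prob_space "Pi\<^sub>M I (\<lambda>_. M)"
    using assms by (intro prob_space_PiM)
  have "distr (Pi\<^sub>M I (\<lambda>_. M)) (Pi\<^sub>M I (\<lambda>_. M)) (\<lambda>x. \<lambda>i\<in>I. x i) = Pi\<^sub>M I (\<lambda>_. M)"
    by (rule trans[OF distr_cong[OF refl refl] distr_id2]) (auto simp: space_PiM PiE_restrict)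
  moreover have "(\<Pi>\<^sub>M i\<in>I. distr (Pi\<^sub>M I (\<lambda>_. M)) M (\<lambda>x. x i)) = Pi\<^sub>M I (\<lambda>_. M)"
    using assms by (intro PiM_cong distr_PiM_component[where M = "\<lambda>_. M"]) auto
  ultimately show ?thesis
    using assms by (subst P.indep_vars_iff_distr_eq_PiM') auto
qed

lemma empirical_Hoeffding:
  fixes \<mu> :: "'a::euclidean_space measure"
  assumes "prob_space \<mu>" and s: "sets \<mu> = sets borel" and A: "A \<in> sets borel" and "n > 0" "0 \<le> \<tau>"
  defines "P \<equiv> Pi\<^sub>M {..<n} (\<lambda>_. \<mu>)"
  shows "{xs \<in> space P. \<tau> \<le> \<bar>measure (empirical xs n) A - measure \<mu> A\<bar>} \<in> sets P"
    and "measure P {xs \<in> space P. \<tau> \<le> \<bar>measure (empirical xs n) A - measure \<mu> A\<bar>} \<le> 2 * exp (- 2 * real n * \<tau>\<^sup>2)"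
proof -
  interpret \<mu>: prob_space \<mu> by fact
  interpret P: prob_space P
    unfolding P_def using assms(1) by (intro prob_space_PiM)
  define Y where "Y i xs = (indicator A (xs i) :: real)" for i and xs :: "nat \<Rightarrow> 'a"
  have A\<mu>: "A \<in> sets \<mu>" using A s by simp
  have ind: "P.indep_vars (\<lambda>_. \<mu>) (\<lambda>i x. x i) {..<n}"
    unfolding P_def using assms by (intro indep_vars_PiM_components) auto
  have indY: "P.indep_vars (\<lambda>_. borel) Y {..<n}"
    unfolding Y_def using A\<mu> by (intro P.indep_vars_compose2[OF ind]) auto
  have expY: "P.expectation (Y i) = measure \<mu> A" if "i < n" for i
  proof -
    have "P.expectation (Y i) = (\<integral>x. indicator A x \<partial>distr P \<mu> (\<lambda>x. x i))"
      unfolding Y_def using that A\<mu> by (intro integral_distr[symmetric]) (auto simp: P_def)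
    also have "distr P \<mu> (\<lambda>x. x i) = \<mu>"
      unfolding P_def using that assms(1) by (intro distr_PiM_component) auto
    finally show ?thesis using A\<mu> by simp
  qed
  interpret H: Hoeffding_ineq P "{..<n}" Y "\<lambda>_. 0" "\<lambda>_. 1" "real n * measure \<mu> A"
    by unfold_locales (auto simp: indY expY Y_def indicator_def)
  have "(\<tau> \<le> \<bar>measure (empirical xs n) A - measure \<mu> A\<bar>) = (real n * \<tau> \<le> \<bar>(\<Sum>i<n. Y i xs) - real n * measure \<mu> A\<bar>)" for xs
  proof -
    have "measure (empirical xs n) A - measure \<mu> A = ((\<Sum>i<n. Y i xs) - real n * measure \<mu> A) / real n"
      using \<open>n > 0\<close> A by (simp add: measure_empirical Y_def field_simps)
    then show ?thesis
      unfolding \<open>measure _ _ - _ = _\<close> abs_divide using \<open>n > 0\<close> by (simp add: pos_le_divide_eq mult.commute)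
  qed
  then have eq: "{xs \<in> space P. \<tau> \<le> \<bar>measure (empirical xs n) A - measure \<mu> A\<bar>} =
      {xs \<in> space P. \<bar>(\<Sum>i<n. Y i xs) - real n * measure \<mu> A\<bar> \<ge> real n * \<tau>}"
    by simp
  have [measurable]: "Y i \<in> borel_measurable P" if "i < n" for i
    using H.random_variable that by simp
  show "{xs \<in> space P. \<tau> \<le> \<bar>measure (empirical xs n) A - measure \<mu> A\<bar>} \<in> sets P"
    unfolding eq by measurable
  have "P.prob {xs \<in> space P. \<bar>(\<Sum>i<n. Y i xs) - real n * measure \<mu> A\<bar> \<ge> real n * \<tau>}
      \<le> 2 * exp (- 2 * (real n * \<tau>)\<^sup>2 / (\<Sum>i<n. (1 - 0)\<^sup>2))"
    using assms by (intro H.Hoeffding_ineq_abs_ge) auto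
  also have "- 2 * (real n * \<tau>)\<^sup>2 / (\<Sum>i<n. (1 - 0)\<^sup>2) = - 2 * real n * \<tau>\<^sup>2"
    using \<open>n > 0\<close> by (simp add: power2_eq_square field_simps)
  finally show "measure P {xs \<in> space P. \<tau> \<le> \<bar>measure (empirical xs n) A - measure \<mu> A\<bar>} \<le> 2 * exp (- 2 * real n * \<tau>\<^sup>2)"
    unfolding eq .
qed

text \<open>A union bound over the bad events. Sample points lie in \<open>X\<close> only almost
  surely, so this is made part of the event \<open>E\<close>, at no loss of probability.\<close>

lemma empirical_uniform_deviation:
  fixes \<mu> :: "'a::euclidean_space measure" and A :: "'i \<Rightarrow> 'a set"
  assumes \<mu>: "prob_on X \<mu>" and X: "X \<in> sets borel" and "n > 0"
    and fin: "finite I" and A: "\<And>i. i \<in> I \<Longrightarrow> A i \<in> sets borel" and \<tau>: "\<And>i. i \<in> I \<Longrightarrow> 0 \<le> \<tau> i"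
  defines "P \<equiv> Pi\<^sub>M {..<n} (\<lambda>_. \<mu>)"
  obtains E where "E \<in> sets P"
    and "\<And>xs. xs \<in> E \<Longrightarrow> prob_on X (empirical xs n)"
    and "\<And>xs i. xs \<in> E \<Longrightarrow> i \<in> I \<Longrightarrow> \<bar>measure (empirical xs n) (A i) - measure \<mu> (A i)\<bar> \<le> \<tau> i"
    and "measure P E \<ge> 1 - (\<Sum>i\<in>I. 2 * exp (- 2 * real n * (\<tau> i)\<^sup>2))"
proof -
  have ps: "prob_space \<mu>" and s: "sets \<mu> = sets borel"
    using \<mu> by (simp_all add: prob_on_def)
  interpret \<mu>: prob_space \<mu> by fact
  interpret P: prob_space P
    unfolding P_def using ps by (intro prob_space_PiM)
  define B where "B i = {xs \<in> space P. \<tau> i \<le> \<bar>measure (empirical xs n) (A i) - measure \<mu> (A i)\<bar>}" for i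
  have B: "B i \<in> sets P" "measure P (B i) \<le> 2 * exp (- 2 * real n * (\<tau> i)\<^sup>2)" if "i \<in> I" for i
    unfolding B_def P_def
    by (intro empirical_Hoeffding[OF ps s A[OF that] \<open>n > 0\<close> \<tau>[OF that]])+
  define F where "F = {xs \<in> space P. \<forall>i\<in>{..<n}. xs i \<in> X}"
  have F: "F \<in> sets P"
  proof -
    have Xm: "X \<in> sets \<mu>" using X s by simp
    have "{xs \<in> space P. xs i \<in> X} \<in> sets P" if "i \<in> {..<n}" for i
      unfolding P_def using that Xm by measurable
    then show ?thesis unfolding F_def by (intro sets.sets_Collect_finite_All) auto
  qed
  have "AE xs in P. \<forall>i\<in>{..<n}. xs i \<in> X"
  proof (intro AE_finite_allI)
    fix i assume "i \<in> {..<n}"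
    then show "AE xs in P. xs i \<in> X"
      unfolding P_def using ps prob_on_AE[OF \<mu> X] by (intro AE_PiM_component)
  qed simp
  then have F1: "P.prob F = 1"
    using P.prob_eq_1[OF F] by (simp add: F_def)
  have BU: "(\<Union>i\<in>I. B i) \<in> sets P"
    using fin B(1) by (intro sets.finite_UN) auto
  have "P.prob (\<Union>i\<in>I. B i) \<le> (\<Sum>i\<in>I. P.prob (B i))"
    using fin B(1) by (intro P.finite_measure_subadditive_finite) auto
  also have "\<dots> \<le> (\<Sum>i\<in>I. 2 * exp (- 2 * real n * (\<tau> i)\<^sup>2))"
    by (intro sum_mono B)
  finally have U: "P.prob (\<Union>i\<in>I. B i) \<le> (\<Sum>i\<in>I. 2 * exp (- 2 * real n * (\<tau> i)\<^sup>2))" .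
  have "P.prob F \<le> P.prob ((F - (\<Union>i\<in>I. B i)) \<union> (\<Union>i\<in>I. B i))"
    using F BU by (intro P.finite_measure_mono) auto
  also have "\<dots> \<le> P.prob (F - (\<Union>i\<in>I. B i)) + P.prob (\<Union>i\<in>I. B i)"
    using F BU by (intro measure_Un_le) auto
  finally have "P.prob (F - (\<Union>i\<in>I. B i)) \<ge> 1 - (\<Sum>i\<in>I. 2 * exp (- 2 * real n * (\<tau> i)\<^sup>2))"
    using U F1 by simp
  moreover have "prob_on X (empirical xs n)" if "xs \<in> F - (\<Union>i\<in>I. B i)" for xs
    using that by (intro prob_on_empirical \<open>n > 0\<close> X) (auto simp: F_def)
  moreover have "\<bar>measure (empirical xs n) (A i) - measure \<mu> (A i)\<bar> \<le> \<tau> i"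
    if "xs \<in> F - (\<Union>i\<in>I. B i)" "i \<in> I" for xs i
    using that by (auto simp: F_def B_def)
  moreover have "F - (\<Union>i\<in>I. B i) \<in> sets P" using F BU by auto
  ultimately show ?thesis
    using that[of "F - (\<Union>i\<in>I. B i)"] by blast
qed

text \<open>The cells with nonnegative difference and those with negative difference each form one
  admissible \<open>T\<close>; together they account for the whole l1 sum, hence the factor
  2.\<close>

lemma cell_discrepancy_le:
  assumes "finite S"
    and T: "\<And>T. T \<subseteq> c ` S \<Longrightarrow> \<bar>\<Sum>s\<in>{s\<in>S. c s \<in> T}. a s - b s\<bar> \<le> \<tau>"
  shows "cell_discrepancy S c a b \<le> 2 * \<tau>"
proof -
  define \<Delta> where "\<Delta> u = (\<Sum>s\<in>{s\<in>S. c s = u}. a s - b s)" for u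
  have eq: "(\<Sum>u\<in>T. \<Delta> u) = (\<Sum>s\<in>{s\<in>S. c s \<in> T}. a s - b s)" if "T \<subseteq> c ` S" for T
  proof -
    have finT: "finite T" using that assms(1) by (auto intro: finite_subset)
    have "(\<Sum>s\<in>{s\<in>S. c s \<in> T}. a s - b s) = (\<Sum>u\<in>T. \<Sum>s\<in>{s \<in> {s\<in>S. c s \<in> T}. c s = u}. a s - b s)"
      using assms(1) finT by (intro sum.group[symmetric]) auto
    also have "\<dots> = (\<Sum>u\<in>T. \<Delta> u)"
      unfolding \<Delta>_def by (intro sum.cong) auto
    finally show ?thesis ..
  qed
  let ?Pos = "{u \<in> c ` S. 0 \<le> \<Delta> u}" and ?Neg = "{u \<in> c ` S. \<not> 0 \<le> \<Delta> u}"
  have "cell_discrepancy S c a b = (\<Sum>u\<in>c ` S. if 0 \<le> \<Delta> u then \<Delta> u else - \<Delta> u)"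
    unfolding cell_discrepancy_def \<Delta>_def[symmetric] by (intro sum.cong) auto
  also have "\<dots> = (\<Sum>u\<in>?Pos. \<Delta> u) + (\<Sum>u\<in>?Neg. - \<Delta> u)"
    using assms(1) by (subst sum.If_cases) (auto simp: Int_def)
  also have "(\<Sum>u\<in>?Pos. \<Delta> u) \<le> \<tau>"
    using T[of ?Pos] eq[of ?Pos] by auto
  also have "(\<Sum>u\<in>?Neg. - \<Delta> u) \<le> \<tau>"
    using T[of ?Neg] eq[of ?Neg] by (auto simp: sum_negf)
  finally show ?thesis by simp
qed

text \<open>
  The total variation over a finite partition is attained on a union of cells, so a union bound over
  all subsets of cells turns Hoeffding's inequality into the rate \<open>sqrt (N / n)\<close> for \<open>N\<close> cells.
\<close>
lemma empirical_dyadic_discrepancy: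
  fixes \<mu> :: "'a::euclidean_space measure"
  assumes \<mu>: "prob_on X \<mu>" and X: "compact X" "diameter X \<le> 1" and "n > 0"
  defines "P \<equiv> Pi\<^sub>M {..<n} (\<lambda>_. \<mu>)"
  obtains E where "E \<in> sets P"
    and "\<And>xs. xs \<in> E \<Longrightarrow> prob_on X (empirical xs n)"
    and "\<And>xs j. xs \<in> E \<Longrightarrow> j \<le> J \<Longrightarrow>
           cell_discrepancy (dyadic_key J ` X) (coarse_key J j)
             (\<lambda>s. measure \<mu> {x. dyadic_key J x = s})
             (\<lambda>s. measure (empirical xs n) {x. dyadic_key J x = s})
           \<le> 2 * sqrt ((5 ^ DIM('a) * 2 ^ (j * DIM('a)) + ln n) / n)"
    and "measure P E \<ge> 1 - 2 * real (J + 1) / real n ^ 2"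
proof -
  define S where "S = dyadic_key J ` X"
  define N :: "nat \<Rightarrow> real" where "N j = 5 ^ DIM('a) * 2 ^ (j * DIM('a))" for j
  \<comment> \<open>Chosen so that 2 n \<tau>^2 = 2 N + 2 ln n: the first term outweighs the at most
    2^N unions of cells of a level, the second leaves failure probability 2 / n^2 per level.\<close>
  define \<tau> where "\<tau> j = sqrt ((N j + ln n) / n)" for j
  define I where "I = Sigma {..J} (\<lambda>j. Pow (dyadic_key j ` X))"
  define A where "A i = {x. dyadic_key J x \<in> S \<and> coarse_key J (fst i) (dyadic_key J x) \<in> snd i}" for i
  have bX: "bounded X" using X by (simp add: compact_imp_bounded)
  have Xb: "X \<in> sets borel" using X by (simp add: compact_imp_closed borel_closed)
  have finS: "finite S" unfolding S_def by (rule dyadic_key_image[OF bX X(2)])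
  have finI: "finite I"
    unfolding I_def using dyadic_key_image(1)[OF bX X(2)] by auto
  have A_eq: "A i = (\<Union>s\<in>{s\<in>S. coarse_key J (fst i) s \<in> snd i}. {x. dyadic_key J x = s})" for i
    by (auto simp: A_def)
  have A: "A i \<in> sets borel" for i
    unfolding A_eq using finS by (intro sets.finite_UN dyadic_cell_measurable) auto
  have mA: "measure M (A i) = (\<Sum>s\<in>{s\<in>S. coarse_key J (fst i) s \<in> snd i}. measure M {x. dyadic_key J x = s})"
    if "prob_on X M" for M i
  proof -
    interpret prob_space M using that by (simp add: prob_on_def)
    have "sets M = sets borel" using that by (simp add: prob_on_def)
    then have sub: "(\<lambda>s. {x. dyadic_key J x = s}) ` T \<subseteq> sets M" for T
      using dyadic_cell_measurable by blast
    show ?thesis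
      unfolding A_eq using finS
      by (intro finite_measure_finite_Union[OF _ sub]) (auto simp: disjoint_family_on_def)
  qed
  have N1: "N j \<ge> 1" for j
    unfolding N_def by (simp add: one_le_power mult_ge1_I)
  have ln0: "ln (real n) \<ge> 0" using \<open>n > 0\<close> by simp
  have Nln: "N j + ln n \<ge> 0" for j using N1[of j] ln0 by simp
  have \<tau>0: "\<tau> j \<ge> 0" for j
    unfolding \<tau>_def using Nln by simp
  obtain E where E: "E \<in> sets P" "\<And>xs. xs \<in> E \<Longrightarrow> prob_on X (empirical xs n)"
    "\<And>xs i. xs \<in> E \<Longrightarrow> i \<in> I \<Longrightarrow> \<bar>measure (empirical xs n) (A i) - measure \<mu> (A i)\<bar> \<le> \<tau> (fst i)"
    "measure P E \<ge> 1 - (\<Sum>i\<in>I. 2 * exp (- 2 * real n * (\<tau> (fst i))\<^sup>2))"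
    unfolding P_def
    using empirical_uniform_deviation[OF \<mu> Xb \<open>n > 0\<close> finI, of A "\<lambda>i. \<tau> (fst i)"] A \<tau>0 by blast
  show ?thesis
  proof (rule that[OF E(1,2)])
    fix xs j assume xs: "xs \<in> E" and j: "j \<le> J"
    have im: "coarse_key J j ` S = dyadic_key j ` X"
      unfolding S_def by (rule coarse_key_image[OF j])
    have "cell_discrepancy S (coarse_key J j)
             (\<lambda>s. measure \<mu> {x. dyadic_key J x = s})
             (\<lambda>s. measure (empirical xs n) {x. dyadic_key J x = s}) \<le> 2 * \<tau> j"
    proof (rule cell_discrepancy_le[OF finS])
      fix T assume T: "T \<subseteq> coarse_key J j ` S"
      then have "(j, T) \<in> I" using j by (simp add: I_def im)
      from E(3)[OF xs this]
      have "\<bar>measure \<mu> (A (j, T)) - measure (empirical xs n) (A (j, T))\<bar> \<le> \<tau> j"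
        by (simp add: abs_minus_commute)
      then show "\<bar>\<Sum>s\<in>{s\<in>S. coarse_key J j s \<in> T}. measure \<mu> {x. dyadic_key J x = s} -
          measure (empirical xs n) {x. dyadic_key J x = s}\<bar> \<le> \<tau> j"
        using mA[OF \<mu>, of "(j, T)"] mA[OF E(2)[OF xs], of "(j, T)"] by (simp add: sum_subtractf)
    qed
    then show "cell_discrepancy (dyadic_key J ` X) (coarse_key J j)
             (\<lambda>s. measure \<mu> {x. dyadic_key J x = s})
             (\<lambda>s. measure (empirical xs n) {x. dyadic_key J x = s})
           \<le> 2 * sqrt ((5 ^ DIM('a) * 2 ^ (j * DIM('a)) + ln n) / n)"
      by (simp add: S_def \<tau>_def N_def)
  next
    have "(\<Sum>i\<in>I. 2 * exp (- 2 * real n * (\<tau> (fst i))\<^sup>2)) = (\<Sum>j\<le>J. \<Sum>T\<in>Pow (dyadic_key j ` X). 2 * exp (- 2 * real n * (\<tau> j)\<^sup>2))"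
      unfolding I_def using dyadic_key_image(1)[OF bX X(2)]
      by (subst sum.Sigma) (auto simp: case_prod_unfold)
    also have "\<dots> \<le> (\<Sum>j\<le>J. 2 / real n ^ 2)"
    proof (rule sum_mono)
      fix j
      have "2 ^ card (dyadic_key j ` X) \<le> exp (1 :: real) ^ card (dyadic_key j ` X)"
        using exp_ge_add_one_self[of 1] by (intro power_mono) auto
      also have "\<dots> = exp (real (card (dyadic_key j ` X)))"
        by (simp flip: exp_of_nat_mult)
      also have "\<dots> \<le> exp (2 * N j)"
      proof -
        have "real (card (dyadic_key j ` X)) \<le> real (5 ^ DIM('a) * 2 ^ (j * DIM('a)))"
          using dyadic_key_image(2)[OF bX X(2), of j] by (simp only: of_nat_le_iff)
        then show ?thesis using N1[of j] by (simp add: N_def)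
      qed
      finally have c: "2 ^ card (dyadic_key j ` X) \<le> exp (2 * N j)" .
      have "2 * real n * (\<tau> j)\<^sup>2 = 2 * N j + 2 * ln n"
        using Nln[of j] \<open>n > 0\<close> by (simp add: \<tau>_def field_simps)
      then have "exp (- 2 * real n * (\<tau> j)\<^sup>2) = exp (- (2 * N j) - 2 * ln n)"
        by simp
      also have "\<dots> = 1 / (exp (2 * N j) * real n ^ 2)"
      proof -
        have "exp (2 * ln (real n)) = real n ^ 2"
          using \<open>n > 0\<close> by (metis exp_double exp_ln of_nat_0_less_iff)
        then show ?thesis by (simp add: exp_diff exp_minus field_simps)
      qed
      finally have e: "exp (- 2 * real n * (\<tau> j)\<^sup>2) = 1 / (exp (2 * N j) * real n ^ 2)" .
      have "(\<Sum>T\<in>Pow (dyadic_key j ` X). 2 * exp (- 2 * real n * (\<tau> j)\<^sup>2)) =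
          2 ^ card (dyadic_key j ` X) * (2 * (1 / (exp (2 * N j) * real n ^ 2)))"
        unfolding e using dyadic_key_image(1)[OF bX X(2), of j] by (simp add: card_Pow)
      also have "\<dots> \<le> exp (2 * N j) * (2 * (1 / (exp (2 * N j) * real n ^ 2)))"
        by (intro mult_right_mono c) simp
      also have "\<dots> = 2 / real n ^ 2" by simp
      finally show "(\<Sum>T\<in>Pow (dyadic_key j ` X). 2 * exp (- 2 * real n * (\<tau> j)\<^sup>2)) \<le> 2 / real n ^ 2" .
    qed
    also have "\<dots> = 2 * real (J + 1) / real n ^ 2" by (simp add: field_simps)
    finally show "measure P E \<ge> 1 - 2 * real (J + 1) / real n ^ 2"
      using E(4) by simp
  qed
qed

subsection \<open>Choice of the dyadic levels\<close>

lemma power2_bracket: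
  fixes y :: real
  assumes "1 \<le> y"
  obtains j :: nat where "2 ^ j \<le> y" "y < 2 * 2 ^ j"
proof -
  obtain m :: nat where "y < 2 ^ m" using real_arch_pow[of 2 y] by auto
  define l where "l = (LEAST m. y < (2::real) ^ m)"
  have l: "y < 2 ^ l" unfolding l_def by (rule LeastI) fact
  with assms have "l \<noteq> 0" by (cases l) auto
  then obtain j where j: "l = Suc j" by (cases l) auto
  then have "\<not> y < 2 ^ j" unfolding l_def using not_less_Least[of j "\<lambda>m. y < 2 ^ m"] by auto
  with l j show ?thesis by (intro that[of j]) auto
qed

lemma sqrt_dyadic:
  fixes n :: real
  assumes "n > 0"
  shows "sqrt (2 ^ (j * d) / n) = (2 ^ j) powr (real d / 2) * n powr (- (1/2))"
proof -
  have "(2::real) ^ (j * d) = (2 ^ j) powr real d"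
    by (simp add: power_mult powr_realpow)
  then have "sqrt (2 ^ (j * d) / n) = ((2 ^ j) powr real d / n) powr (1/2)"
    using assms by (simp add: powr_half_sqrt)
  also have "\<dots> = ((2 ^ j) powr real d) powr (1/2) / n powr (1/2)"
    using assms by (simp add: powr_divide)
  also have "\<dots> = (2 ^ j) powr (real d / 2) * n powr (- (1/2))"
    by (simp add: powr_powr powr_minus_divide)
  finally show ?thesis .
qed

text \<open>Mass left over at level \<open>Suc j\<close> is moved inside cells of level
  \<open>j\<close>. The sign of \<open>d / 2 - p\<close> decides whether fine or coarse levels cost
  more, which is the case distinction of the rate.\<close>

lemma level_cost_eq:
  fixes n :: real
  assumes "n > 0"
  shows "(1 / 2 ^ j) powr p * sqrt (2 ^ (Suc j * d) / n) =
     2 powr (real d / 2) * ((2 ^ j) powr (real d / 2 - p) * n powr (- (1/2)))"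
proof -
  have 1: "(1 / 2 ^ j) powr p = ((2::real) ^ j) powr (- p)"
    by (simp add: powr_divide powr_minus_divide)
  have 2: "((2::real) ^ Suc j) powr (real d / 2) = 2 powr (real d / 2) * (2 ^ j) powr (real d / 2)"
    by (simp add: powr_mult)
  have 3: "((2::real) ^ j) powr (- p) * (2 ^ j) powr (real d / 2) = (2 ^ j) powr (real d / 2 - p)"
    by (simp flip: powr_add)
  have "(1 / 2 ^ j) powr p * sqrt (2 ^ (Suc j * d) / n) =
      (2 ^ j) powr (- p) * ((2 ^ Suc j) powr (real d / 2) * n powr (- (1/2)))"
    by (simp only: 1 sqrt_dyadic[OF assms])
  also have "\<dots> = 2 powr (real d / 2) * ((2 ^ j) powr (- p) * (2 ^ j) powr (real d / 2) * n powr (- (1/2)))"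
    by (simp only: 2 mult_ac)
  finally show ?thesis by (simp only: 3)
qed

text \<open>Moving the whole mass within the finest cells, of side about n^(-1/d), must stay within
  the rate. For p > d/2 this amounts to p d \<le> p (d + 2) - d, that is d \<le> 2 p.\<close>

lemma rpw_rate_ge:
  assumes "1 \<le> p" "d \<ge> 1" "n \<ge> 1"
  shows "real n powr (- (1 / d)) \<le> rpw_rate d p n"
proof (cases "p \<le> real d / 2")
  case False
  have "p * (real d + 2) - d = p * d + (2 * p - d)" "0 \<le> p * d"
    using assms by (auto simp: algebra_simps)
  with False have den: "0 < p * (real d + 2) - d" "p * d \<le> p * (real d + 2) - d"
    by linarith+
  have "p / (p * (real d + 2) - d) \<le> 1 / d"
    using den assms by (simp add: pos_divide_le_eq pos_le_divide_eq)
  then show ?thesis using False assms by (simp add: rpw_rate_def powr_mono)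
qed (simp add: rpw_rate_def)

text \<open>In \<open>C\<close> the factor 2^p pays for rounding side lengths to powers of two, and
  2^(d/2) for the shift between \<open>j\<close> and \<open>Suc j\<close> in the level cost.\<close>

lemma dyadic_levels:
  fixes p :: real and d n :: nat
  assumes p: "1 \<le> p" and d: "d \<ge> 1" and n: "n \<ge> 2"
  defines "C \<equiv> 2 powr p * 2 powr (d / 2)"
  obtains j\<^sub>0 J :: nat where "j\<^sub>0 \<le> J" "2 ^ J \<le> n"
    and "sqrt (2 ^ (j\<^sub>0 * d) / n) \<le> C * rpw_rate d p n"
    and "(1 / 2 ^ J) powr p \<le> C * rpw_rate d p n powr p"
    and "\<And>j. j\<^sub>0 \<le> j \<Longrightarrow> j < J \<Longrightarrow> (1 / 2 ^ j) powr p * sqrt (2 ^ (Suc j * d) / n) \<le> C * rpw_rate d p n powr p"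
proof -
  define r where "r = rpw_rate d p n"
  have n0: "real n > 0" "real n \<ge> 1" using n by simp_all
  have r0: "r > 0" unfolding r_def rpw_rate_def using n by auto
  have r_ge: "real n powr (- (1 / d)) \<le> r"
    unfolding r_def using p d n by (intro rpw_rate_ge) auto
  have two: "2 powr p \<ge> (1::real)" "2 powr (d / 2) \<ge> (1::real)"
    using p by (auto intro!: ge_one_powr_ge_zero)
  then have C1: "C \<ge> 1" "C \<ge> 2 powr p" "C \<ge> 2 powr (d/2)"
    unfolding C_def using mult_mono[OF two(1) two(2)] by (auto simp: mult_le_cancel_left1 mult_le_cancel_right1)
  define y where "y = real n powr (1 / d)"
  have y1: "y \<ge> 1" unfolding y_def using n0 by (intro ge_one_powr_ge_zero) auto
  obtain J where J: "2 ^ J \<le> y" "y < 2 * 2 ^ J" using power2_bracket[OF y1] .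
  have "y \<le> real n powr 1" unfolding y_def using n0 d by (intro powr_mono) auto
  with J(1) n0 have "real (2 ^ J) \<le> real n" unfolding of_nat_power of_nat_numeral powr_one[OF less_imp_le[OF n0(1)]] by linarith
  then have Jn: "2 ^ J \<le> n" by (simp only: of_nat_le_iff)
  have Jfin: "(1 / 2 ^ J) powr p \<le> C * r powr p"
  proof -
    have "1 / 2 ^ J \<le> 2 / y" using J y1 by (simp add: field_simps)
    also have "\<dots> = 2 * real n powr (- (1 / d))"
      by (simp add: y_def powr_minus divide_inverse)
    also have "\<dots> \<le> 2 * r" using r_ge by simp
    finally have "(1 / 2 ^ J) powr p \<le> (2 * r) powr p"
      using p by (intro powr_mono2) auto
    also have "\<dots> = 2 powr p * r powr p" using r0 by (simp add: powr_mult)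
    also have "\<dots> \<le> C * r powr p" using C1 by (intro mult_right_mono) auto
    finally show ?thesis .
  qed
  show ?thesis
  proof (cases "p \<le> real d / 2")
    case True
    have r: "r = real n powr (- (1 / d))" using True by (simp add: r_def rpw_rate_def)
    \<comment> \<open>Since p is at least 1, this case forces d \<ge> 2, so the loss n^(-1/2) of
      matching up to level 0 is within n^(-1/d).\<close>
    have d2: "real d \<ge> 2" using True p by simp
    show ?thesis
    proof (rule that[of 0 J, folded r_def])
      have "sqrt (2 ^ (0 * d) / real n) = real n powr (- (1/2))"
        using n0 by (subst sqrt_dyadic) auto
      also have "\<dots> \<le> r" unfolding r using n0 d2 by (intro powr_mono) (auto simp: field_simps)
      also have "\<dots> \<le> C * r" using C1 r0 by simp
      finally show "sqrt (2 ^ (0 * d) / real n) \<le> C * r" .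
      fix j assume "j < J"
      then have "(2::real) ^ j \<le> 2 ^ J" by (intro power_increasing) auto
      from order_trans[OF this J(1)] have jy: "2 ^ j \<le> y" .
      have "(1 / 2 ^ j) powr p * sqrt (2 ^ (Suc j * d) / real n) =
          2 powr (d / 2) * ((2 ^ j) powr (d / 2 - p) * real n powr (- (1/2)))"
        by (rule level_cost_eq[OF n0(1)])
      also have "\<dots> \<le> 2 powr (d / 2) * (y powr (d / 2 - p) * real n powr (- (1/2)))"
        using jy True by (intro mult_left_mono mult_right_mono powr_mono2) auto
      also have "y powr (d / 2 - p) * real n powr (- (1/2)) = real n powr ((1 / d) * (d / 2 - p) + (- (1/2)))"
        unfolding y_def by (simp only: powr_powr powr_add)
      also have "(1 / d) * (d / 2 - p) + (- (1/2)) = (- (1 / d)) * p"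
        using d by (simp add: field_simps)
      also have "real n powr \<dots> = r powr p" unfolding r by (simp only: powr_powr)
      also have "2 powr (d / 2) * r powr p \<le> C * r powr p"
        using C1 by (intro mult_right_mono) auto
      finally show "(1 / 2 ^ j) powr p * sqrt (2 ^ (Suc j * d) / real n) \<le> C * r powr p" .
    qed (use Jn Jfin in auto)
  next
    case False
    define q where "q = p / (p * (real d + 2) - real d)"
    have r: "r = real n powr (- q)" using False by (simp add: r_def rpw_rate_def q_def)
    have "p * (real d + 2) - d = p * d + (2 * p - d)" "0 \<le> p * d"
      using p by (auto simp: algebra_simps)
    with False have den: "p * (real d + 2) - d > 0" by linarith
    have q0: "q > 0" unfolding q_def using den p by simp
    \<comment> \<open>The balance equation for the exponent: with z as below, it says that z^(d/2)
      n^(-1/2) equals r.\<close>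
    have q_id: "q * (p - 1) / p * (d / 2) + (- (1/2)) = - q"
      unfolding q_def using den p by (simp add: divide_simps) (simp add: algebra_simps)
    have q_le: "q \<le> 1 / d"
    proof -
      have "real n powr (- (1 / d)) \<le> real n powr (- q)" using r_ge r by simp
      then show ?thesis using n by (simp add: powr_le_cancel_iff)
    qed
    \<comment> \<open>z = r^(-(p-1)/p) is the inverse of the optimal coarsest side; it satisfies
      z^(-p) r = r^p, which bounds the cost of level \<open>j\<^sub>0\<close>.\<close>
    define z where "z = real n powr (q * (p - 1) / p)"
    have z1: "z \<ge> 1" unfolding z_def using n0 q0 p by (intro ge_one_powr_ge_zero) auto
    obtain j\<^sub>0 where j0: "2 ^ j\<^sub>0 \<le> z" "z < 2 * 2 ^ j\<^sub>0" using power2_bracket[OF z1] .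
    have "q * (p - 1) / p \<le> q * 1" using p q0 by (simp add: field_simps)
    then have "z \<le> y" unfolding z_def y_def using q_le n0 by (intro powr_mono) auto
    with j0 J have "(2::real) ^ j\<^sub>0 < 2 ^ Suc J" unfolding power_Suc by linarith
    then have "j\<^sub>0 < Suc J" by (subst (asm) power_strict_increasing_iff) auto
    then have j0J: "j\<^sub>0 \<le> J" by simp
    have base: "(2 ^ j\<^sub>0) powr (d / 2) * real n powr (- (1/2)) \<le> r"
    proof -
      have "(2 ^ j\<^sub>0) powr (d / 2) * real n powr (- (1/2)) \<le> z powr (d / 2) * real n powr (- (1/2))"
        using j0 by (intro mult_right_mono powr_mono2) auto
      also have "\<dots> = real n powr (q * (p - 1) / p * (d / 2) + (- (1/2)))"
        unfolding z_def by (simp only: powr_powr powr_add)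
      also have "\<dots> = r" unfolding q_id r ..
      finally show ?thesis .
    qed
    show ?thesis
    proof (rule that[of j\<^sub>0 J, folded r_def])
      have "sqrt (2 ^ (j\<^sub>0 * d) / real n) \<le> r"
        using base n0 by (simp only: sqrt_dyadic)
      also have "\<dots> \<le> C * r" using C1 r0 by simp
      finally show "sqrt (2 ^ (j\<^sub>0 * d) / real n) \<le> C * r" .
      fix j assume j: "j\<^sub>0 \<le> j" "j < J"
      then have jj: "(2::real) ^ j\<^sub>0 \<le> 2 ^ j" by (intro power_increasing) auto
      have "(1 / 2 ^ j) powr p * sqrt (2 ^ (Suc j * d) / real n) =
          2 powr (d / 2) * ((2 ^ j) powr (d / 2 - p) * real n powr (- (1/2)))"
        by (rule level_cost_eq[OF n0(1)])
      also have "\<dots> \<le> 2 powr (d / 2) * ((2 ^ j\<^sub>0) powr (d / 2 - p) * real n powr (- (1/2)))"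
        using jj False by (intro mult_left_mono mult_right_mono powr_mono2') auto
      also have "(2 ^ j\<^sub>0) powr (d / 2 - p) * real n powr (- (1/2)) =
          (2 ^ j\<^sub>0) powr (- p) * ((2 ^ j\<^sub>0) powr (d / 2) * real n powr (- (1/2)))"
        by (simp only: mult.assoc[symmetric] powr_add[symmetric]) (simp add: algebra_simps)
      also have "\<dots> \<le> (z / 2) powr (- p) * r"
      proof (intro mult_mono base)
        show "(2 ^ j\<^sub>0) powr (- p) \<le> (z / 2) powr (- p)"
          using j0 z1 p by (intro powr_mono2') auto
      qed auto
      also have "(z / 2) powr (- p) * r = 2 powr p * (z powr (- p) * r)"
        using z1 by (simp add: powr_divide powr_minus field_simps)
      also have "z powr (- p) * r = real n powr (q * (p - 1) / p * (- p) + (- q))"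
        unfolding z_def r by (simp only: powr_powr powr_add)
      also have "q * (p - 1) / p * (- p) + (- q) = (- q) * p"
        using p by (simp add: field_simps)
      also have "real n powr \<dots> = r powr p" unfolding r by (simp only: powr_powr)
      finally show "(1 / 2 ^ j) powr p * sqrt (2 ^ (Suc j * d) / real n) \<le> C * r powr p"
        by (simp add: C_def mult_ac)
    qed (use Jn Jfin j0J in auto)
  qed
qed

subsection \<open>The rate\<close>

lemma dyadic_transport_density:
  fixes \<mu> \<mu>' :: "'a::euclidean_space measure"
  assumes on: "prob_on X \<mu>" "prob_on X \<mu>'" and X: "compact X" "diameter X \<le> 1"
    and "1 \<le> p" "j\<^sub>0 \<le> J"
    and \<delta>: "\<And>j. j \<le> J \<Longrightarrow> cell_discrepancy (dyadic_key J ` X) (coarse_key J j)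
             (\<lambda>s. measure \<mu> {x. dyadic_key J x = s}) (\<lambda>s. measure \<mu>' {x. dyadic_key J x = s}) \<le> \<delta> j"
    and e: "\<delta> j\<^sub>0 \<le> e"
    and KJ: "(DIM('a) / 2 ^ J) powr p \<le> K"
    and K: "\<And>j. j\<^sub>0 \<le> j \<Longrightarrow> j < J \<Longrightarrow> (DIM('a) / 2 ^ j) powr p * \<delta> (Suc j) \<le> K"
    and tot: "real (Suc (J - j\<^sub>0)) * K \<le> D powr p"
  obtains h where "transport_density p e D \<mu> \<mu>' h"
proof -
  interpret \<mu>: prob_space \<mu> using on by (simp add: prob_on_def)
  interpret \<mu>': prob_space \<mu>' using on by (simp add: prob_on_def)
  have s: "sets \<mu> = sets borel" "sets \<mu>' = sets borel" using on by (simp_all add: prob_on_def)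
  have bX: "bounded X" using X by (simp add: compact_imp_bounded)
  define S where "S = dyadic_key J ` X"
  define a where "a s = measure \<mu> {x. dyadic_key J x = s}" for s
  define b where "b s = measure \<mu>' {x. dyadic_key J x = s}" for s
  define w where "w s t = key_dist J s t powr p" for s t :: "'a \<Rightarrow> int"
  have finS: "finite S" unfolding S_def by (rule dyadic_key_image[OF bX X(2)])
  \<comment> \<open>Only cells that meet \<open>X\<close> are indexed. They carry the full mass of
    \<mu>, and the loss of the matching is measured from 1.\<close>
  have "measure \<mu> X = 1" using on(1) by (simp add: prob_on_def measure_def)
  moreover have "measure \<mu> X \<le> measure \<mu> (\<Union>s\<in>S. {x. dyadic_key J x = s})"
    using finS s dyadic_cell_measurable
    by (intro \<mu>.finite_measure_mono sets.finite_UN) (auto simp: S_def)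
  moreover have "measure \<mu> (\<Union>s\<in>S. {x. dyadic_key J x = s}) = sum a S"
    unfolding a_def using finS s dyadic_cell_measurable
    by (intro \<mu>.finite_measure_finite_Union) (auto simp: disjoint_family_on_def)
  ultimately have a1: "sum a S = 1"
    using \<mu>.prob_le_1[of "\<Union>s\<in>S. {x. dyadic_key J x = s}"] by linarith
  have key0: "0 \<le> key_dist J s t" for s t :: "'a \<Rightarrow> int"
    unfolding key_dist_def by (intro sum_nonneg) auto
  obtain G where G: "cell_plan S (coarse_key J j\<^sub>0) a b G"
    "1 - (\<Sum>s\<in>S. \<Sum>t\<in>S. G s t) \<le> cell_discrepancy S (coarse_key J j\<^sub>0) a b"
    "(\<Sum>s\<in>S. \<Sum>t\<in>S. G s t * w s t) \<le> real (Suc (J - j\<^sub>0)) * K"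
  proof (rule hierarchical_matching[where S = S and a = a and b = b and c = "coarse_key J" and w = w
        and D = "\<lambda>j. (DIM('a) / 2 ^ j) powr p" and j\<^sub>0 = j\<^sub>0 and J = J and K = K])
    show "w s t \<le> (DIM('a) / 2 ^ j) powr p" if "j \<le> J" "coarse_key J j s = coarse_key J j t" for j s t
      unfolding w_def using key_dist_le[OF that] key0 \<open>1 \<le> p\<close> by (intro powr_mono2) auto
    show "(DIM('a) / 2 ^ j) powr p * cell_discrepancy S (coarse_key J (Suc j)) a b \<le> K" if "j\<^sub>0 \<le> j" "j < J" for j
    proof -
      have "(DIM('a) / 2 ^ j) powr p * cell_discrepancy S (coarse_key J (Suc j)) a b \<le> (DIM('a) / 2 ^ j) powr p * \<delta> (Suc j)"
        using \<delta>[of "Suc j"] that unfolding S_def a_def b_def by (intro mult_left_mono) auto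
      also have "\<dots> \<le> K" by (rule K[OF that])
      finally show ?thesis .
    qed
  qed (use finS a1 \<open>j\<^sub>0 \<le> J\<close> KJ in \<open>auto simp: a_def b_def intro: coarse_key_nested\<close>)
  have "dist x y powr p \<le> w (dyadic_key J x) (dyadic_key J y)" for x y
    unfolding w_def using dist_le_key_dist \<open>1 \<le> p\<close> by (intro powr_mono2) auto
  moreover have "1 - (\<Sum>s\<in>S. \<Sum>t\<in>S. G s t) \<le> e"
    using G(2) \<delta>[OF \<open>j\<^sub>0 \<le> J\<close>] e unfolding S_def a_def b_def by linarith
  moreover have "(\<Sum>s\<in>S. \<Sum>t\<in>S. G s t * w s t) \<le> D powr p"
    using G(3) tot by linarith
  ultimately show ?thesis
    using that transport_density_of_cell_plan[OF \<mu>.prob_space_axioms \<mu>'.prob_space_axioms s finS dyadic_cell_measurable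
        G(1)[unfolded a_def b_def]] by blast
qed

text \<open>One logarithm comes from the deviation bound and one from the number of levels. Both
  enter the p-th power of the cost, where p \<ge> 1 lets (ln n)^2 be absorbed into ((ln n)^2)^p. The
  hypothesis n \<ge> 3 makes ln n at least 1.\<close>

lemma dyadic_levels_log:
  fixes p k :: real and d :: nat
  assumes p: "1 \<le> p" and d: "d \<ge> 1" and k: "k > 0"
  defines "\<delta> \<equiv> \<lambda>n j. 2 * sqrt ((5 ^ d * 2 ^ (j * d) + ln (real n)) / real n)"
  obtains C :: real where "C > 0"
    and "\<And>n. n \<ge> 3 \<Longrightarrow> \<exists>j\<^sub>0 J K. j\<^sub>0 \<le> J \<and> 2 ^ J \<le> n \<and>
        \<delta> n j\<^sub>0 \<le> C * (ln n)\<^sup>2 * rpw_rate d p n \<and>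
        (d / 2 ^ J) powr p \<le> K \<and>
        (\<forall>j. j\<^sub>0 \<le> j \<and> j < J \<longrightarrow> (d / 2 ^ j) powr p * \<delta> n (Suc j) \<le> K) \<and>
        real (Suc (J - j\<^sub>0)) * K \<le> (k * (C * (ln n)\<^sup>2 * rpw_rate d p n)) powr p"
proof -
  define C\<^sub>1 where "C\<^sub>1 = 2 powr p * 2 powr (d / 2)"
  have C1: "C\<^sub>1 > 0" by (simp add: C\<^sub>1_def)
  define B :: real where "B = 4 * 5 ^ d"
  have B: "B \<ge> 1" unfolding B_def using one_le_power[of "5::real" d] by linarith
  \<comment> \<open>\<open>M\<close> is kept at least 1 so that it is bounded by its own p-th power;
    the quotient by \<open>k\<close> in \<open>C\<close> then restores it inside
    \<open>k * C\<close>.\<close>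
  define M where "M = max 1 (3 * (d powr p * B * C\<^sub>1))"
  have M1: "M \<ge> 1" by (simp add: M_def)
  define C where "C = max (M / k) (B * C\<^sub>1)"
  have C0: "C > 0" unfolding C_def using B C1 by (auto simp: less_max_iff_disj)
  have kC: "M \<le> k * C"
  proof -
    have "M / k \<le> C" by (simp add: C_def)
    then show ?thesis using k by (simp add: pos_divide_le_eq mult.commute)
  qed
  have "\<exists>j\<^sub>0 J K. j\<^sub>0 \<le> J \<and> 2 ^ J \<le> n \<and>
        \<delta> n j\<^sub>0 \<le> C * (ln n)\<^sup>2 * rpw_rate d p n \<and>
        (d / 2 ^ J) powr p \<le> K \<and>
        (\<forall>j. j\<^sub>0 \<le> j \<and> j < J \<longrightarrow> (d / 2 ^ j) powr p * \<delta> n (Suc j) \<le> K) \<and>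
        real (Suc (J - j\<^sub>0)) * K \<le> (k * (C * (ln n)\<^sup>2 * rpw_rate d p n)) powr p"
    if n: "n \<ge> 3" for n
  proof -
    define r where "r = rpw_rate d p n"
    define L where "L = ln (real n)"
    have r0: "r > 0" unfolding r_def rpw_rate_def using n by auto
    have "exp 1 \<le> real n" using exp_le n by linarith
    then have L1: "L \<ge> 1" unfolding L_def using n by (subst ln_ge_iff) auto
    have "L * 1 \<le> L * L" using L1 by (intro mult_left_mono) auto
    then have L2: "L \<le> L\<^sup>2" "1 \<le> L\<^sup>2" unfolding power2_eq_square using L1 by linarith+
    obtain j\<^sub>0 J where J: "j\<^sub>0 \<le> J" "2 ^ J \<le> n"
      and lev0: "sqrt (2 ^ (j\<^sub>0 * d) / n) \<le> C\<^sub>1 * r"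
      and levJ: "(1 / 2 ^ J) powr p \<le> C\<^sub>1 * r powr p"
      and lev: "\<And>j. j\<^sub>0 \<le> j \<Longrightarrow> j < J \<Longrightarrow> (1 / 2 ^ j) powr p * sqrt (2 ^ (Suc j * d) / n) \<le> C\<^sub>1 * r powr p"
      unfolding C\<^sub>1_def r_def using dyadic_levels[of p d n] p d n by auto
    have \<delta>: "\<delta> n j \<le> B * L * sqrt (2 ^ (j * d) / n)" for j
    proof -
      have t: "(1::real) \<le> 2 ^ (j * d)" "(1::real) \<le> 5 ^ d" by simp_all
      have "1 * L \<le> 5 ^ d * L" using t L1 by (intro mult_right_mono) auto
      moreover have "5 ^ d * 1 \<le> 5 ^ d * L" using L1 by (intro mult_left_mono) auto
      ultimately have q: "5 ^ d + L \<le> 2 * 5 ^ d * L" by linarith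
      have "5 ^ d * 2 ^ (j * d) + L \<le> 5 ^ d * 2 ^ (j * d) + L * 2 ^ (j * d)"
        using t L1 by simp
      also have "\<dots> = (5 ^ d + L) * 2 ^ (j * d)" by (simp add: distrib_right)
      also have "\<dots> \<le> (2 * 5 ^ d * L) * 2 ^ (j * d)"
        by (intro mult_right_mono q) simp
      \<comment> \<open>Squaring a factor that is at least 1 lets it leave the square root; this
        wastes only a constant and half a logarithm.\<close>
      also have "\<dots> \<le> (2 * 5 ^ d * L)\<^sup>2 * 2 ^ (j * d)"
      proof (intro mult_right_mono)
        have u: "(1::real) \<le> 2 * 5 ^ d" using t(2) by linarith
        have "1 * 1 \<le> (2 * 5 ^ d) * L" by (intro mult_mono u L1) auto
        then show "2 * 5 ^ d * L \<le> (2 * 5 ^ d * L)\<^sup>2"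
          by (intro self_le_power) auto
      qed simp
      finally have "(5 ^ d * 2 ^ (j * d) + L) / n \<le> (2 * 5 ^ d * L)\<^sup>2 * 2 ^ (j * d) / n"
        by (intro divide_right_mono) auto
      then have "sqrt ((5 ^ d * 2 ^ (j * d) + L) / n) \<le> sqrt ((2 * 5 ^ d * L)\<^sup>2 * (2 ^ (j * d) / n))"
        by simp
      also have "\<dots> = 2 * 5 ^ d * L * sqrt (2 ^ (j * d) / n)"
        using L1 by (simp only: real_sqrt_mult real_sqrt_abs) simp
      finally show ?thesis unfolding \<delta>_def B_def L_def by linarith
    qed
    define K where "K = d powr p * B * C\<^sub>1 * L * r powr p"
    have dp: "(d / 2 ^ j) powr p = d powr p * (1 / 2 ^ j) powr p" for j
      by (simp add: powr_divide)
    have 1: "\<delta> n j\<^sub>0 \<le> C * L\<^sup>2 * r"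
    proof -
      have "\<delta> n j\<^sub>0 \<le> B * L * (C\<^sub>1 * r)"
        using B L1 by (intro order_trans[OF \<delta>] mult_left_mono lev0) auto
      also have "\<dots> = (B * C\<^sub>1) * L * r" by simp
      also have "\<dots> \<le> C * L\<^sup>2 * r"
        using L2 B C1 C0 r0 L1 by (intro mult_right_mono mult_mono) (auto simp: C_def)
      finally show ?thesis .
    qed
    have 2: "(d / 2 ^ J) powr p \<le> K"
    proof -
      have "(d / 2 ^ J) powr p \<le> d powr p * (C\<^sub>1 * r powr p)"
        unfolding dp by (intro mult_left_mono levJ) auto
      also have "\<dots> * 1 \<le> d powr p * (C\<^sub>1 * r powr p) * (B * L)"
        using B L1 C1 mult_mono[OF B L1] by (intro mult_left_mono) auto
      also have "\<dots> = K" by (simp add: K_def mult_ac)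
      finally show ?thesis by simp
    qed
    have 3: "(d / 2 ^ j) powr p * \<delta> n (Suc j) \<le> K" if "j\<^sub>0 \<le> j" "j < J" for j
    proof -
      have "(d / 2 ^ j) powr p * \<delta> n (Suc j) \<le> (d powr p * (1 / 2 ^ j) powr p) * (B * L * sqrt (2 ^ (Suc j * d) / n))"
        unfolding dp by (intro mult_left_mono \<delta>) auto
      also have "\<dots> = (d powr p * B * L) * ((1 / 2 ^ j) powr p * sqrt (2 ^ (Suc j * d) / n))"
        by (simp only: mult_ac)
      also have "\<dots> \<le> (d powr p * B * L) * (C\<^sub>1 * r powr p)"
        using B L1 by (intro mult_left_mono lev that) auto
      also have "\<dots> = K" by (simp add: K_def mult_ac)
      finally show ?thesis .
    qed
    have 4: "real (Suc (J - j\<^sub>0)) * K \<le> (k * (C * L\<^sup>2 * r)) powr p"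
    proof -
      \<comment> \<open>From 2^J \<le> n and ln 2 \<ge> 1/2 one gets J \<le> 2 L; the one extra
        level is absorbed by L \<ge> 1, giving at most 3 L levels.\<close>
      have "ln (2 ^ J) \<le> ln (real n)"
        using J(2) n by (subst ln_le_cancel_iff) (auto simp flip: of_nat_le_iff)
      then have "real J * ln 2 \<le> L" by (simp add: L_def ln_realpow)
      moreover have "real J * (1 / 2) \<le> real J * ln 2"
        using ln2_ge_two_thirds by (intro mult_left_mono) auto
      ultimately have "real (Suc (J - j\<^sub>0)) \<le> 3 * L" using L1 by simp
      moreover have "K \<ge> 0" unfolding K_def using B C1 L1 by auto
      ultimately have "real (Suc (J - j\<^sub>0)) * K \<le> 3 * L * K" by (rule mult_right_mono)
      also have "\<dots> = 3 * (d powr p * B * C\<^sub>1) * L\<^sup>2 * r powr p"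
        by (simp add: K_def power2_eq_square mult_ac)
      also have "\<dots> \<le> M * L\<^sup>2 * r powr p"
        by (intro mult_right_mono) (auto simp: M_def)
      also have "\<dots> \<le> M powr p * L\<^sup>2 powr p * r powr p"
      proof (intro mult_right_mono mult_mono)
        show "M \<le> M powr p" using powr_mono[of 1 p M] p M1 by simp
        show "L\<^sup>2 \<le> L\<^sup>2 powr p" using powr_mono[of 1 p "L\<^sup>2"] p L2 by simp
      qed auto
      also have "\<dots> \<le> (k * C) powr p * L\<^sup>2 powr p * r powr p"
        using kC M1 p by (intro mult_right_mono powr_mono2) auto
      also have "\<dots> = (k * (C * L\<^sup>2 * r)) powr p"
        using k C0 r0 by (simp add: powr_mult mult_ac)
      finally show ?thesis .
    qed
    from J 1 2 3 4 show ?thesis unfolding r_def L_def by blast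
  qed
  then show ?thesis by (rule that[OF C0])
qed

theorem theorem3p7:
  fixes \<mu> \<nu> :: "'a::euclidean_space measure"
    and X :: "'a set"
    and p k :: real
  assumes "compact X" and "diameter X \<le> 1"
    and "prob_space \<mu>" and "sets \<mu> = sets borel" and "emeasure \<mu> X = 1"
    and "prob_space \<nu>" and "sets \<nu> = sets borel" and "emeasure \<nu> X = 1"
    and "p \<ge> 1" and "k > 0"
  shows "\<exists>C a c N. C > 0 \<and> a \<ge> 0 \<and> c > 0 \<and>
     (\<forall>n \<ge> N.
        (\<exists>E \<in> sets (Pi\<^sub>M {..<n} (\<lambda>_. \<mu>) \<Otimes>\<^sub>M Pi\<^sub>M {..<n} (\<lambda>_. \<nu>)).
           E \<subseteq> {(xs, ys). \<bar>RPW p k \<mu> \<nu> - RPW p k (empirical xs n) (empirical ys n)\<bar>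
                       \<le> C * ln (real n) powr a * rpw_rate DIM('a) p n} \<and>
           measure (Pi\<^sub>M {..<n} (\<lambda>_. \<mu>) \<Otimes>\<^sub>M Pi\<^sub>M {..<n} (\<lambda>_. \<nu>)) E
             \<ge> 1 - real n powr (- c)))"
proof -
  note X = \<open>compact X\<close> \<open>diameter X \<le> 1\<close>
  have \<mu>: "prob_on X \<mu>" and \<nu>: "prob_on X \<nu>"
    using assms by (simp_all add: prob_on_def)
  obtain C :: real where C: "C > 0" and levels: "\<And>n. n \<ge> 3 \<Longrightarrow> \<exists>j\<^sub>0 J K. j\<^sub>0 \<le> J \<and> 2 ^ J \<le> n \<and>
        2 * sqrt ((5 ^ DIM('a) * 2 ^ (j\<^sub>0 * DIM('a)) + ln (real n)) / real n) \<le> C * (ln n)\<^sup>2 * rpw_rate DIM('a) p n \<and>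
        (DIM('a) / 2 ^ J) powr p \<le> K \<and>
        (\<forall>j. j\<^sub>0 \<le> j \<and> j < J \<longrightarrow>
          (DIM('a) / 2 ^ j) powr p * (2 * sqrt ((5 ^ DIM('a) * 2 ^ (Suc j * DIM('a)) + ln (real n)) / real n)) \<le> K) \<and>
        real (Suc (J - j\<^sub>0)) * K \<le> (k * (C * (ln n)\<^sup>2 * rpw_rate DIM('a) p n)) powr p"
    by (rule dyadic_levels_log[OF \<open>p \<ge> 1\<close> _ \<open>k > 0\<close>, of "DIM('a)"]) auto
  \<comment> \<open>Each sample fails with probability at most 2 / n, both together with at most 4 /
    n, and 4 / n \<le> n^(-1/2) holds from n = 16 on.\<close>
  have main: "\<exists>E \<in> sets (Pi\<^sub>M {..<n} (\<lambda>_. \<mu>) \<Otimes>\<^sub>M Pi\<^sub>M {..<n} (\<lambda>_. \<nu>)).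
           E \<subseteq> {(xs, ys). \<bar>RPW p k \<mu> \<nu> - RPW p k (empirical xs n) (empirical ys n)\<bar>
                       \<le> (2 * C) * ln (real n) powr 2 * rpw_rate DIM('a) p n} \<and>
           measure (Pi\<^sub>M {..<n} (\<lambda>_. \<mu>) \<Otimes>\<^sub>M Pi\<^sub>M {..<n} (\<lambda>_. \<nu>)) E
             \<ge> 1 - real n powr (- (1/2))" if n: "n \<ge> 16" for n
  proof -
    define e where "e = C * (ln n)\<^sup>2 * rpw_rate DIM('a) p n"
    define \<delta> where "\<delta> j = 2 * sqrt ((5 ^ DIM('a) * 2 ^ (j * DIM('a)) + ln (real n)) / real n)" for j
    \<comment> \<open>The levels do not depend on the distributions, so one choice serves both
      samples; each replaced marginal then costs one \<open>e\<close>.\<close>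
    obtain j\<^sub>0 J K where J: "j\<^sub>0 \<le> J" "2 ^ J \<le> n" and K: "\<delta> j\<^sub>0 \<le> e" "(DIM('a) / 2 ^ J) powr p \<le> K"
      "\<And>j. j\<^sub>0 \<le> j \<Longrightarrow> j < J \<Longrightarrow> (DIM('a) / 2 ^ j) powr p * \<delta> (Suc j) \<le> K"
      "real (Suc (J - j\<^sub>0)) * K \<le> (k * e) powr p"
      using levels[of n] n unfolding \<delta>_def e_def by auto
    have e0: "e \<ge> 0" unfolding e_def using C by (auto simp: rpw_rate_def)
    define P where "P = Pi\<^sub>M {..<n} (\<lambda>_. \<mu>)"
    define Q where "Q = Pi\<^sub>M {..<n} (\<lambda>_. \<nu>)"
    interpret P: prob_space P unfolding P_def using assms by (intro prob_space_PiM)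
    interpret Q: prob_space Q unfolding Q_def using assms by (intro prob_space_PiM)
    have n0: "n > 0" using n by simp
    obtain E\<^sub>1 where E1: "E\<^sub>1 \<in> sets P" "\<And>xs. xs \<in> E\<^sub>1 \<Longrightarrow> prob_on X (empirical xs n)"
      "\<And>xs j. xs \<in> E\<^sub>1 \<Longrightarrow> j \<le> J \<Longrightarrow> cell_discrepancy (dyadic_key J ` X) (coarse_key J j)
             (\<lambda>s. measure \<mu> {x. dyadic_key J x = s})
             (\<lambda>s. measure (empirical xs n) {x. dyadic_key J x = s}) \<le> \<delta> j"
      "measure P E\<^sub>1 \<ge> 1 - 2 * real (J + 1) / real n ^ 2"
      unfolding P_def \<delta>_def using empirical_dyadic_discrepancy[OF \<mu> X n0, of J] by blast
    obtain E\<^sub>2 where E2: "E\<^sub>2 \<in> sets Q" "\<And>xs. xs \<in> E\<^sub>2 \<Longrightarrow> prob_on X (empirical xs n)"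
      "\<And>xs j. xs \<in> E\<^sub>2 \<Longrightarrow> j \<le> J \<Longrightarrow> cell_discrepancy (dyadic_key J ` X) (coarse_key J j)
             (\<lambda>s. measure \<nu> {x. dyadic_key J x = s})
             (\<lambda>s. measure (empirical xs n) {x. dyadic_key J x = s}) \<le> \<delta> j"
      "measure Q E\<^sub>2 \<ge> 1 - 2 * real (J + 1) / real n ^ 2"
      unfolding Q_def \<delta>_def using empirical_dyadic_discrepancy[OF \<nu> X n0, of J] by blast
    have close: "\<bar>RPW p k \<mu> \<nu> - RPW p k (empirical xs n) (empirical ys n)\<bar> \<le> 2 * e"
      if xs: "xs \<in> E\<^sub>1" and ys: "ys \<in> E\<^sub>2" for xs ys
    proof -
      obtain h where h: "transport_density p e (k * e) \<mu> (empirical xs n) h"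
        by (rule dyadic_transport_density[OF \<mu> E1(2)[OF xs] X \<open>p \<ge> 1\<close> J(1) E1(3)[OF xs] K])
      obtain h' where h': "transport_density p e (k * e) \<nu> (empirical ys n) h'"
        by (rule dyadic_transport_density[OF \<nu> E2(2)[OF ys] X \<open>p \<ge> 1\<close> J(1) E2(3)[OF ys] K])
      show ?thesis
        using \<open>p \<ge> 1\<close> \<open>k > 0\<close> e0
        by (intro RPW_diff_le_transport[OF X \<mu> \<nu> E1(2)[OF xs] E2(2)[OF ys] _ _ _ h h']) auto
    qed
    have "E\<^sub>1 \<times> E\<^sub>2 \<in> sets (P \<Otimes>\<^sub>M Q)" using E1(1) E2(1) by simp
    moreover have "E\<^sub>1 \<times> E\<^sub>2 \<subseteq> {(xs, ys). \<bar>RPW p k \<mu> \<nu> - RPW p k (empirical xs n) (empirical ys n)\<bar>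
                       \<le> (2 * C) * ln (real n) powr 2 * rpw_rate DIM('a) p n}"
      using close n by (auto simp: e_def mult_ac)
    moreover have "measure (P \<Otimes>\<^sub>M Q) (E\<^sub>1 \<times> E\<^sub>2) \<ge> 1 - real n powr (- (1/2))"
    proof -
      define x where "x = 2 / real n"
      have "J + 1 \<le> 2 ^ J" by (induction J) auto
      with J(2) have Jn: "J + 1 \<le> n" by linarith
      then have "2 * real (J + 1) / real n ^ 2 \<le> 2 * real n / real n ^ 2"
        by (intro divide_right_mono mult_left_mono) (simp_all only: of_nat_le_iff, auto)
      also have "\<dots> = x" using n0 by (simp add: x_def power2_eq_square)
      finally have Jx: "2 * real (J + 1) / real n ^ 2 \<le> x" .
      have x: "0 \<le> 1 - x" using n by (simp add: x_def field_simps)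
      have "measure (P \<Otimes>\<^sub>M Q) (E\<^sub>1 \<times> E\<^sub>2) = measure P E\<^sub>1 * measure Q E\<^sub>2"
        using E1(1) E2(1) by (simp add: measure_def Q.emeasure_pair_measure_Times enn2real_mult)
      also have "\<dots> \<ge> (1 - x) * (1 - x)"
        using E1(4) E2(4) Jx x by (intro mult_mono) auto
      also have "(1 - x) * (1 - x) \<ge> 1 - 2 * x" by (simp add: algebra_simps)
      also have "1 - 2 * x \<ge> 1 - real n powr (- (1/2))"
      proof -
        have "4 = sqrt (16 :: real)" by simp
        also have "\<dots> \<le> sqrt (real n)" using n by (intro real_sqrt_le_mono) simp
        finally have s: "4 \<le> sqrt (real n)" .
        have "2 * x = 4 / (sqrt (real n) * sqrt (real n))" by (simp add: x_def)
        also have "\<dots> \<le> sqrt (real n) / (sqrt (real n) * sqrt (real n))"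
          using s by (intro divide_right_mono) auto
        also have "\<dots> = 1 / sqrt (real n)"
          using n0 by (intro nonzero_divide_mult_cancel_left) simp
        also have "\<dots> = real n powr (- (1/2))"
          by (simp add: powr_minus_divide powr_half_sqrt)
        finally show ?thesis by simp
      qed
      finally show ?thesis .
    qed
    ultimately show ?thesis unfolding P_def Q_def by blast
  qed
  show ?thesis
    by (intro exI[of _ "2 * C"] exI[of _ 2] exI[of _ "1/2"] exI[of _ 16] conjI allI impI main)
      (use C in auto)
qed

end
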